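(* Let $f\colon\mathbb{R}^n\to\mathbb{R}$ be continuously differentiable, let $F\colon\mathbb{R}^n\to\mathbb{R}^\ell$ be directionally differentiable and locally Lipschitz continuous, and let $\Gamma\subseteq\mathbb{R}^\ell$ be nonempty and closed. Let $\bar x\in\mathbb{R}^n$ be a local minimizer of $\min_x f(x)$ s.t. $F(x)\in\Gamma$. Then the following assertions hold. (a) If $\bar x$ is AM-regular, then $\bar x$ is M-stationary. (b) Fix $d\in\widehat C(\bar x)\cap\mathbb{S}$. If $\bar x$ is AM-regular in direction $d$, then $\bar x$ is M-stationary; if $\bar x$ is strongly AM-regular in direction $d$, then $\bar x$ is M-stationary in direction $d$. (c) Fix $d\in C(\bar x)\cap\mathbb{S}$, and let GACQ hold at $\bar x$. If $\bar x$ is AM-regular in direction $d$, then $\bar x$ is M-stationary; if $\bar x$ is strongly AM-regular in direction $d$, then $\bar x$ is M-stationary in direction $d$. (d) If $\bar x$ is AM-regular in direction $d$ for all $d\in C(\bar x)\cap\mathbb{S}$, then $\bar x$ is M-stationary.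
   Context: Notation. $\|\cdot\|$ is the Euclidean norm, $\mathbb{S}$ the unit sphere of $\mathbb{R}^n$. For a closed set $\Omega\subseteq\mathbb{R}^m$, $z\in\Omega$, $w\in\mathbb{R}^m$: $T_\Omega(z)=\{v : \exists v^k\to v,\ t_k\downarrow 0,\ z+t_kv^k\in\Omega\ \forall k\}$; $\widehat N_\Omega(z)=\{\eta : \eta^\top v\le 0\ \forall v\in T_\Omega(z)\}$; $N_\Omega(z)=\{\eta : \exists z^k\to z,\ z^k\in\Omega,\ \eta^k\to\eta,\ \eta^k\in\widehat N_\Omega(z^k)\ \forall k\}$; $N_\Omega(z;w)=\{\eta : \exists w^k\to w,\ t_k\downarrow0,\ \eta^k\to\eta,\ \eta^k\in\widehat N_\Omega(z+t_kw^k)\ \forall k\}$. All are empty if $z\notin\Omega$. For a directionally differentiable, locally Lipschitz $\varphi\colon\mathbb{R}^n\to\mathbb{R}$: $\partial\varphi(x;d)=\{\xi : (\xi,-1)\in N_{\operatorname{epi}\varphi}((x,\varphi(x));(d,\varphi'(x;d)))\}$ and $\partial\varphi(x)=\partial\varphi(x;0)=\{\xi:(\xi,-1)\in N_{\operatorname{epi}\varphi}((x,\varphi(x)))\}$, where $\varphi'(x;d)$ is the directional derivative and $\operatorname{epi}\varphi=\{(x,\alpha):\varphi(x)\le\alpha\}$. $\langle\lambda,F\rangle(x)=\lambda^\top F(x)$. For vectors $v^k$ and $\alpha_k\ge0$, $v^k\in o(\alpha_k)$ means $\|v^k\|\le\alpha_k\epsilon_k$ for all $k$ with some null sequence $\epsilon_k\ge0$.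 Feasible set: $X=F^{-1}(\Gamma)$. Linearization cone: $T^{\rm lin}_{F,\Gamma}(\bar x)=\{d : F'(\bar x;d)\in T_\Gamma(F(\bar x))\}$. Critical cones: $\widehat C(\bar x)=\{d : f'(\bar x)d\le0,\ d\in T_X(\bar x)\}$ (implicit) and $C(\bar x)=\{d : f'(\bar x)d\le0,\ d\in T^{\rm lin}_{F,\Gamma}(\bar x)\}$ (explicit). GACQ (generalized Abadie constraint qualification) at $\bar x$: $T_X(\bar x)=T^{\rm lin}_{F,\Gamma}(\bar x)$. A feasible point $\bar x$ is M-stationary if there is $\lambda\in\mathbb{R}^\ell$ with $-\nabla f(\bar x)\in\partial\langle\lambda,F\rangle(\bar x)$ and $\lambda\in N_\Gamma(F(\bar x))$. For $d\in C(\bar x)$ it is M-stationary in direction $d$ if there is $\lambda$ with $-\nabla f(\bar x)\in\partial\langle\lambda,F\rangle(\bar x;d)$ and $\lambda\in N_\Gamma(F(\bar x);F'(\bar x;d))$. Regularity. For a sequence $\{(x^k,\lambda^k,\delta^k,\xi^k)\}\subseteq\mathbb{R}^{n+\ell+\ell+n}$ and $\xi\in\mathbb{R}^n$ consider: (R1) $\xi^k\in\partial\langle\lambda^k,F\rangle(x^k)$ and $\lambda^k\in N_\Gamma(F(x^k)-\delta^k)$ for all $k$; (R2) $(x^k,\delta^k,\xi^k,\|\lambda^k\|)\to(\bar x,0,\xi,\infty)$; (R3) $x^k\ne\bar x$ for all $k$, $(x^k-\bar x)/\|x^k-\bar x\|\to d$, $\delta^k/\|x^k-\bar x\|\to0$,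 $\|\delta^k\|\lambda^k-\|\lambda^k\|\delta^k\in o(\|\delta^k\|\|\lambda^k\|)$, and $\{\|\delta^k\|\|\lambda^k\|/\|x^k-\bar x\|\}_k$ is bounded. A feasible point $\bar x$ is AM-regular if for every such sequence and $\xi$ satisfying (R1), (R2) there is $\lambda\in N_\Gamma(F(\bar x))$ with $\xi\in\partial\langle\lambda,F\rangle(\bar x)$. For $d\in T^{\rm lin}_{F,\Gamma}(\bar x)\cap\mathbb{S}$, $\bar x$ is AM-regular in direction $d$ if for every such sequence and $\xi$ satisfying (R1), (R2), (R3) there is $\lambda\in N_\Gamma(F(\bar x))$ with $\xi\in\partial\langle\lambda,F\rangle(\bar x)$; it is strongly AM-regular in direction $d$ if for every such sequence and $\xi$ satisfying (R1), (R2), (R3) there is $\lambda\in N_\Gamma(F(\bar x);F'(\bar x;d))$ with $\xi\in\partial\langle\lambda,F\rangle(\bar x;d)$. *)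

theory Defs
  imports "HOL-Analysis.Analysis"
begin

section \<open>Tangent and normal cones\<close>

text \<open>Here \<open>t\<^sub>k \<down> 0\<close> means \<open>t\<^sub>k > 0\<close> and \<open>t\<^sub>k \<rightarrow> 0\<close>; monotonicity is not required.
  All cones are empty at points outside the set. For the regular normal cone this has to
  be demanded explicitly, since the polar of the empty set is the whole space.\<close>

definition tangent_cone :: "'a::euclidean_space set \<Rightarrow> 'a \<Rightarrow> 'a set" where
  "tangent_cone \<Omega> z = {v. z \<in> \<Omega> \<and> (\<exists>vs ts. vs \<longlonglongrightarrow> v \<and> (\<forall>k. 0 < ts k) \<and> ts \<longlonglongrightarrow> (0::real) \<and>
     (\<forall>k::nat. z + ts k *\<^sub>R vs k \<in> \<Omega>))}"

definition regular_normal_cone :: "'a::euclidean_space set \<Rightarrow> 'a \<Rightarrow> 'a set" where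
  "regular_normal_cone \<Omega> z = {\<eta>. z \<in> \<Omega> \<and> (\<forall>v \<in> tangent_cone \<Omega> z. \<eta> \<bullet> v \<le> 0)}"

definition normal_cone :: "'a::euclidean_space set \<Rightarrow> 'a \<Rightarrow> 'a set" where
  "normal_cone \<Omega> z = {\<eta>. z \<in> \<Omega> \<and> (\<exists>zs \<eta>s. zs \<longlonglongrightarrow> z \<and> (\<forall>k. zs k \<in> \<Omega>) \<and> \<eta>s \<longlonglongrightarrow> \<eta> \<and>
     (\<forall>k::nat. \<eta>s k \<in> regular_normal_cone \<Omega> (zs k)))}"

definition dir_normal_cone :: "'a::euclidean_space set \<Rightarrow> 'a \<Rightarrow> 'a \<Rightarrow> 'a set" where
  "dir_normal_cone \<Omega> z w = {\<eta>. z \<in> \<Omega> \<and> (\<exists>ws ts \<eta>s. ws \<longlonglongrightarrow> w \<and> (\<forall>k. 0 < ts k) \<and> ts \<longlonglongrightarrow> (0::real) \<and>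
     \<eta>s \<longlonglongrightarrow> \<eta> \<and> (\<forall>k::nat. \<eta>s k \<in> regular_normal_cone \<Omega> (z + ts k *\<^sub>R ws k)))}"

lemma dir_normal_cone_0: "dir_normal_cone \<Omega> z 0 = normal_cone \<Omega> z"
proof (intro set_eqI iffI)
  fix \<eta> assume "\<eta> \<in> dir_normal_cone \<Omega> z 0"
  then obtain ws ts \<eta>s where z: "z \<in> \<Omega>" and w: "ws \<longlonglongrightarrow> 0" and t: "ts \<longlonglongrightarrow> (0::real)"
    and e: "\<eta>s \<longlonglongrightarrow> \<eta>" and r: "\<And>k::nat. \<eta>s k \<in> regular_normal_cone \<Omega> (z + ts k *\<^sub>R ws k)"
    unfolding dir_normal_cone_def by blast
  have "(\<lambda>k. z + ts k *\<^sub>R ws k) \<longlonglongrightarrow> z + 0 *\<^sub>R 0"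
    by (intro tendsto_intros w t)
  then have "(\<lambda>k. z + ts k *\<^sub>R ws k) \<longlonglongrightarrow> z" by simp
  moreover have "\<forall>k. z + ts k *\<^sub>R ws k \<in> \<Omega>"
    using r unfolding regular_normal_cone_def by blast
  ultimately show "\<eta> \<in> normal_cone \<Omega> z"
    unfolding normal_cone_def using z e r by blast
next
  fix \<eta> assume "\<eta> \<in> normal_cone \<Omega> z"
  then obtain zs \<eta>s where z: "z \<in> \<Omega>" and zs: "zs \<longlonglongrightarrow> z"
    and e: "\<eta>s \<longlonglongrightarrow> \<eta>" and r: "\<And>k::nat. \<eta>s k \<in> regular_normal_cone \<Omega> (zs k)"
    unfolding normal_cone_def by blast
  define ts where "ts k = sqrt (norm (zs k - z)) + inverse (real (Suc k))" for k
  define ws where "ws k = (zs k - z) /\<^sub>R ts k" for k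
  have pos: "0 < ts k" for k
    unfolding ts_def by (intro add_nonneg_pos) auto
  have n0: "(\<lambda>k. sqrt (norm (zs k - z))) \<longlonglongrightarrow> 0"
    using tendsto_real_sqrt[OF tendsto_norm[OF LIM_zero[OF zs]]] by simp
  have t: "ts \<longlonglongrightarrow> 0"
    unfolding ts_def using tendsto_add[OF n0 LIMSEQ_inverse_real_of_nat] by simp
  have "norm (ws k) \<le> sqrt (norm (zs k - z))" for k
  proof -
    have "norm (zs k - z) = sqrt (norm (zs k - z)) * sqrt (norm (zs k - z))" by simp
    also have "\<dots> \<le> sqrt (norm (zs k - z)) * ts k"
      unfolding ts_def by (intro mult_left_mono) auto
    finally show ?thesis
      using pos[of k] by (simp add: ws_def divide_simps)
  qed
  then have w: "ws \<longlonglongrightarrow> 0"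
    by (intro Lim_null_comparison[OF always_eventually n0]) blast
  have "z + ts k *\<^sub>R ws k = zs k" for k
    using pos[of k] by (simp add: ws_def)
  then have "\<forall>k. \<eta>s k \<in> regular_normal_cone \<Omega> (z + ts k *\<^sub>R ws k)"
    using r by simp
  with z w t e pos show "\<eta> \<in> dir_normal_cone \<Omega> z 0"
    unfolding dir_normal_cone_def by blast
qed


section \<open>Derivatives and subdifferentials\<close>

definition grad :: "('a::euclidean_space \<Rightarrow> real) \<Rightarrow> 'a \<Rightarrow> 'a" where
  "grad f x = (THE D. GDERIV f x :> D)"

lemma grad_eq:
  assumes "GDERIV f x :> D"
  shows "grad f x = D"
  unfolding grad_def
proof (rule the_equality)
  show "GDERIV f x :> D" by (rule assms)
next
  fix E assume "GDERIV f x :> E"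
  then have "(\<lambda>h. h \<bullet> E) = (\<lambda>h. h \<bullet> D)"
    using assms has_derivative_unique unfolding gderiv_def by blast
  then show "E = D"
    by (metis inner_commute vector_eq_ldot)
qed

definition continuously_differentiable :: "('a::euclidean_space \<Rightarrow> real) \<Rightarrow> bool" where
  "continuously_differentiable f \<longleftrightarrow> (\<forall>x. f differentiable at x) \<and> continuous_on UNIV (grad f)"

lemma GDERIV_grad:
  fixes f :: "'a::euclidean_space \<Rightarrow> real"
  assumes "f differentiable at x"
  shows "GDERIV f x :> grad f x"
proof -
  obtain f' where f': "(f has_derivative f') (at x)"
    using assms unfolding differentiable_def by blast
  then have "linear f'" by (rule has_derivative_linear)
  then have "f' = (\<lambda>h. h \<bullet> adjoint f' 1)"
    by (simp add: adjoint_works inner_commute fun_eq_iff)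
  then have "GDERIV f x :> adjoint f' 1"
    using f' unfolding gderiv_def by metis
  then show ?thesis
    using grad_eq by metis
qed

definition dir_deriv :: "('a::euclidean_space \<Rightarrow> 'b::euclidean_space) \<Rightarrow> 'a \<Rightarrow> 'a \<Rightarrow> 'b" where
  "dir_deriv F x d = Lim (at_right 0) (\<lambda>t::real. (F (x + t *\<^sub>R d) - F x) /\<^sub>R t)"

definition directionally_differentiable :: "('a::euclidean_space \<Rightarrow> 'b::euclidean_space) \<Rightarrow> bool" where
  "directionally_differentiable F \<longleftrightarrow>
     (\<forall>x d. \<exists>L. ((\<lambda>t::real. (F (x + t *\<^sub>R d) - F x) /\<^sub>R t) \<longlongrightarrow> L) (at_right 0))"

definition locally_lipschitz :: "('a::euclidean_space \<Rightarrow> 'b::euclidean_space) \<Rightarrow> bool" where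
  "locally_lipschitz F \<longleftrightarrow> (\<forall>x. \<exists>r>0. \<exists>L. L-lipschitz_on (ball x r) F)"

definition subdiff :: "('a::euclidean_space \<Rightarrow> real) \<Rightarrow> 'a \<Rightarrow> 'a set" where
  "subdiff \<phi> x = {\<xi>. (\<xi>, - 1) \<in> normal_cone (epigraph UNIV \<phi>) (x, \<phi> x)}"

definition dir_subdiff :: "('a::euclidean_space \<Rightarrow> real) \<Rightarrow> 'a \<Rightarrow> 'a \<Rightarrow> 'a set" where
  "dir_subdiff \<phi> x d =
     {\<xi>. (\<xi>, - 1) \<in> dir_normal_cone (epigraph UNIV \<phi>) (x, \<phi> x) (d, dir_deriv \<phi> x d)}"

lemma dir_subdiff_0: "dir_subdiff \<phi> x 0 = subdiff \<phi> x"
proof -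
  have "dir_deriv \<phi> x 0 = 0"
    unfolding dir_deriv_def by (intro tendsto_Lim) auto
  then show ?thesis
    unfolding dir_subdiff_def subdiff_def
    using dir_normal_cone_0[of "epigraph UNIV \<phi>" "(x, \<phi> x)"] by (simp add: zero_prod_def)
qed

abbreviation scalarization :: "'b::euclidean_space \<Rightarrow> ('a \<Rightarrow> 'b) \<Rightarrow> 'a \<Rightarrow> real" where
  "scalarization \<mu> F \<equiv> \<lambda>x. \<mu> \<bullet> F x"


section \<open>The problem of minimizing \<open>f\<close> over \<open>F -` \<Gamma>\<close>\<close>

definition local_minimizer :: "('a::euclidean_space \<Rightarrow> real) \<Rightarrow> 'a set \<Rightarrow> 'a \<Rightarrow> bool" where
  "local_minimizer f X x \<longleftrightarrow> x \<in> X \<and> (\<exists>r>0. \<forall>y \<in> X \<inter> ball x r. f x \<le> f y)"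

definition linearization_cone ::
  "('a::euclidean_space \<Rightarrow> 'b::euclidean_space) \<Rightarrow> 'b set \<Rightarrow> 'a \<Rightarrow> 'a set" where
  "linearization_cone F \<Gamma> x = {d. dir_deriv F x d \<in> tangent_cone \<Gamma> (F x)}"

definition implicit_critical_cone ::
  "('a::euclidean_space \<Rightarrow> real) \<Rightarrow> ('a \<Rightarrow> 'b::euclidean_space) \<Rightarrow> 'b set \<Rightarrow> 'a \<Rightarrow> 'a set" where
  "implicit_critical_cone f F \<Gamma> x =
     {d. frechet_derivative f (at x) d \<le> 0 \<and> d \<in> tangent_cone (F -` \<Gamma>) x}"

definition critical_cone ::
  "('a::euclidean_space \<Rightarrow> real) \<Rightarrow> ('a \<Rightarrow> 'b::euclidean_space) \<Rightarrow> 'b set \<Rightarrow> 'a \<Rightarrow> 'a set" where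
  "critical_cone f F \<Gamma> x =
     {d. frechet_derivative f (at x) d \<le> 0 \<and> d \<in> linearization_cone F \<Gamma> x}"

definition GACQ :: "('a::euclidean_space \<Rightarrow> 'b::euclidean_space) \<Rightarrow> 'b set \<Rightarrow> 'a \<Rightarrow> bool" where
  "GACQ F \<Gamma> x \<longleftrightarrow> tangent_cone (F -` \<Gamma>) x = linearization_cone F \<Gamma> x"

definition M_stationary ::
  "('a::euclidean_space \<Rightarrow> real) \<Rightarrow> ('a \<Rightarrow> 'b::euclidean_space) \<Rightarrow> 'b set \<Rightarrow> 'a \<Rightarrow> bool" where
  "M_stationary f F \<Gamma> x \<longleftrightarrow> x \<in> F -` \<Gamma> \<and>
     (\<exists>\<mu>. - grad f x \<in> subdiff (scalarization \<mu> F) x \<and> \<mu> \<in> normal_cone \<Gamma> (F x))"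

definition dir_M_stationary ::
  "('a::euclidean_space \<Rightarrow> real) \<Rightarrow> ('a \<Rightarrow> 'b::euclidean_space) \<Rightarrow> 'b set \<Rightarrow> 'a \<Rightarrow> 'a \<Rightarrow> bool" where
  "dir_M_stationary f F \<Gamma> x d \<longleftrightarrow> x \<in> F -` \<Gamma> \<and> d \<in> critical_cone f F \<Gamma> x \<and>
     (\<exists>\<mu>. - grad f x \<in> dir_subdiff (scalarization \<mu> F) x d \<and>
           \<mu> \<in> dir_normal_cone \<Gamma> (F x) (dir_deriv F x d))"


section \<open>Asymptotic regularity\<close>

text \<open>The bound is required for every index, so that \<open>v k = 0\<close> whenever \<open>\<alpha> k = 0\<close>; this is
  not the Landau symbol of the library, which only constrains all sufficiently large indices.\<close>

definition small_o :: "(nat \<Rightarrow> 'a::euclidean_space) \<Rightarrow> (nat \<Rightarrow> real) \<Rightarrow> bool" where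
  "small_o v \<alpha> \<longleftrightarrow>
     (\<exists>\<epsilon>. (\<forall>k. 0 \<le> \<epsilon> k) \<and> \<epsilon> \<longlonglongrightarrow> 0 \<and> (\<forall>k. norm (v k) \<le> \<alpha> k * \<epsilon> k))"

definition R1 ::
  "('a::euclidean_space \<Rightarrow> 'b::euclidean_space) \<Rightarrow> 'b set \<Rightarrow>
   (nat \<Rightarrow> 'a) \<Rightarrow> (nat \<Rightarrow> 'b) \<Rightarrow> (nat \<Rightarrow> 'b) \<Rightarrow> (nat \<Rightarrow> 'a) \<Rightarrow> bool" where
  "R1 F \<Gamma> xs ls \<delta>s \<xi>s \<longleftrightarrow>
     (\<forall>k. \<xi>s k \<in> subdiff (scalarization (ls k) F) (xs k) \<and> ls k \<in> normal_cone \<Gamma> (F (xs k) - \<delta>s k))"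

definition R2 ::
  "'a::euclidean_space \<Rightarrow> 'a \<Rightarrow>
   (nat \<Rightarrow> 'a) \<Rightarrow> (nat \<Rightarrow> 'b::euclidean_space) \<Rightarrow> (nat \<Rightarrow> 'b) \<Rightarrow> (nat \<Rightarrow> 'a) \<Rightarrow> bool" where
  "R2 x \<xi> xs ls \<delta>s \<xi>s \<longleftrightarrow>
     xs \<longlonglongrightarrow> x \<and> \<delta>s \<longlonglongrightarrow> 0 \<and> \<xi>s \<longlonglongrightarrow> \<xi> \<and> filterlim (\<lambda>k. norm (ls k)) at_top sequentially"

definition R3 ::
  "'a::euclidean_space \<Rightarrow> 'a \<Rightarrow>
   (nat \<Rightarrow> 'a) \<Rightarrow> (nat \<Rightarrow> 'b::euclidean_space) \<Rightarrow> (nat \<Rightarrow> 'b) \<Rightarrow> bool" where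
  "R3 x d xs ls \<delta>s \<longleftrightarrow>
     (\<forall>k. xs k \<noteq> x) \<and>
     (\<lambda>k. (xs k - x) /\<^sub>R norm (xs k - x)) \<longlonglongrightarrow> d \<and>
     (\<lambda>k. \<delta>s k /\<^sub>R norm (xs k - x)) \<longlonglongrightarrow> 0 \<and>
     small_o (\<lambda>k. norm (\<delta>s k) *\<^sub>R ls k - norm (ls k) *\<^sub>R \<delta>s k) (\<lambda>k. norm (\<delta>s k) * norm (ls k)) \<and>
     bounded (range (\<lambda>k. norm (\<delta>s k) * norm (ls k) / norm (xs k - x)))"

definition AM_regular ::
  "('a::euclidean_space \<Rightarrow> 'b::euclidean_space) \<Rightarrow> 'b set \<Rightarrow> 'a \<Rightarrow> bool" where
  "AM_regular F \<Gamma> x \<longleftrightarrow> x \<in> F -` \<Gamma> \<and>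
     (\<forall>xs ls \<delta>s \<xi>s \<xi>. R1 F \<Gamma> xs ls \<delta>s \<xi>s \<and> R2 x \<xi> xs ls \<delta>s \<xi>s \<longrightarrow>
        (\<exists>\<mu> \<in> normal_cone \<Gamma> (F x). \<xi> \<in> subdiff (scalarization \<mu> F) x))"

definition dir_AM_regular ::
  "('a::euclidean_space \<Rightarrow> 'b::euclidean_space) \<Rightarrow> 'b set \<Rightarrow> 'a \<Rightarrow> 'a \<Rightarrow> bool" where
  "dir_AM_regular F \<Gamma> x d \<longleftrightarrow> x \<in> F -` \<Gamma> \<and> d \<in> linearization_cone F \<Gamma> x \<inter> sphere 0 1 \<and>
     (\<forall>xs ls \<delta>s \<xi>s \<xi>. R1 F \<Gamma> xs ls \<delta>s \<xi>s \<and> R2 x \<xi> xs ls \<delta>s \<xi>s \<and> R3 x d xs ls \<delta>s \<longrightarrow>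
        (\<exists>\<mu> \<in> normal_cone \<Gamma> (F x). \<xi> \<in> subdiff (scalarization \<mu> F) x))"

definition strongly_dir_AM_regular ::
  "('a::euclidean_space \<Rightarrow> 'b::euclidean_space) \<Rightarrow> 'b set \<Rightarrow> 'a \<Rightarrow> 'a \<Rightarrow> bool" where
  "strongly_dir_AM_regular F \<Gamma> x d \<longleftrightarrow> x \<in> F -` \<Gamma> \<and> d \<in> linearization_cone F \<Gamma> x \<inter> sphere 0 1 \<and>
     (\<forall>xs ls \<delta>s \<xi>s \<xi>. R1 F \<Gamma> xs ls \<delta>s \<xi>s \<and> R2 x \<xi> xs ls \<delta>s \<xi>s \<and> R3 x d xs ls \<delta>s \<longrightarrow>
        (\<exists>\<mu> \<in> dir_normal_cone \<Gamma> (F x) (dir_deriv F x d).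
           \<xi> \<in> dir_subdiff (scalarization \<mu> F) x d))"

end

theory Submission
  imports Defs
begin

text \<open>Let \<open>xb\<close> be \<open>x\<close>, or feasible at distance of order \<open>t\<close> from \<open>x\<close> in a critical direction,
  so that \<open>f xb - f x = o(t)\<close>. For large \<open>m\<close>, minimize
  \<open>f y + c * \<parallel>y - xb\<parallel>\<^sup>2 + m / 2 * \<parallel>F y - z\<parallel>\<^sup>2\<close> over \<open>y\<close> near \<open>xb\<close> and \<open>z \<in> \<Gamma>\<close>. With \<open>\<delta> = F y - z\<close>
  and multiplier \<open>m * \<delta>\<close>, optimality in \<open>z\<close> gives a regular normal of \<open>\<Gamma>\<close>, and
  optimality in \<open>y\<close> gives a Frechet subgradient of the scalarization directly: expanding the square leaves
  the term \<open>m / 2 * \<parallel>F u - F y\<parallel>\<^sup>2\<close>, which is \<open>O(\<parallel>u - y\<parallel>\<^sup>2)\<close> as \<open>F\<close> is locally Lipschitz.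
  If the multipliers have a bounded subsequence, its limit is a (directional) M-multiplier;
  otherwise these sequences satisfy (R1)--(R3) and the regularity assumption applies.\<close>

section \<open>Frechet subgradients and closest points\<close>

text \<open>The usual lower-limit condition for regular subgradients, with the division by
  \<open>norm (u - y)\<close> cleared, so that \<open>u = y\<close> needs no exception.\<close>

definition frechet_subgradient :: "('a::euclidean_space \<Rightarrow> real) \<Rightarrow> 'a \<Rightarrow> 'a \<Rightarrow> bool" where
  "frechet_subgradient \<phi> y \<xi> \<longleftrightarrow>
     (\<forall>\<epsilon>>0. \<forall>\<^sub>F u in nhds y. \<phi> y + \<xi> \<bullet> (u - y) - \<epsilon> * norm (u - y) \<le> \<phi> u)"

lemma regular_normal_imp_normal:
  assumes "\<eta> \<in> regular_normal_cone \<Omega> z"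
  shows "\<eta> \<in> normal_cone \<Omega> z"
proof -
  have "z \<in> \<Omega>" using assms by (simp add: regular_normal_cone_def)
  then show ?thesis
    unfolding normal_cone_def using assms tendsto_const by blast
qed

lemma dir_normal_subset_normal: "dir_normal_cone \<Omega> z w \<subseteq> normal_cone \<Omega> z"
proof
  fix \<eta> assume "\<eta> \<in> dir_normal_cone \<Omega> z w"
  then obtain ws ts \<eta>s where z: "z \<in> \<Omega>" and w: "ws \<longlonglongrightarrow> w" and t: "ts \<longlonglongrightarrow> (0::real)"
    and e: "\<eta>s \<longlonglongrightarrow> \<eta>" and r: "\<And>k::nat. \<eta>s k \<in> regular_normal_cone \<Omega> (z + ts k *\<^sub>R ws k)"
    unfolding dir_normal_cone_def by blast
  have "(\<lambda>k. z + ts k *\<^sub>R ws k) \<longlonglongrightarrow> z + 0 *\<^sub>R w"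
    by (intro tendsto_intros w t)
  then have "(\<lambda>k. z + ts k *\<^sub>R ws k) \<longlonglongrightarrow> z" by simp
  moreover have "\<forall>k. z + ts k *\<^sub>R ws k \<in> \<Omega>"
    using r unfolding regular_normal_cone_def by blast
  ultimately show "\<eta> \<in> normal_cone \<Omega> z"
    unfolding normal_cone_def using z e r by blast
qed

lemma dir_subdiff_subset_subdiff: "dir_subdiff \<phi> x d \<subseteq> subdiff \<phi> x"
  unfolding dir_subdiff_def subdiff_def using dir_normal_subset_normal by blast

text \<open>Along a tangent sequence of the epigraph, the subgradient inequality divided by the step
  length says that heights grow at least at the rate \<open>\<xi> \<bullet> fst p\<close>, up to an
  arbitrarily small multiple of \<open>norm (fst p)\<close>.\<close>

lemma frechet_subgradient_regular_normal:
  assumes "frechet_subgradient \<phi> y \<xi>"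
  shows "(\<xi>, - 1) \<in> regular_normal_cone (epigraph UNIV \<phi>) (y, \<phi> y)"
  unfolding regular_normal_cone_def mem_Collect_eq
proof (intro conjI ballI)
  show "(y, \<phi> y) \<in> epigraph UNIV \<phi>" by (simp add: mem_epigraph)
next
  fix p assume "p \<in> tangent_cone (epigraph UNIV \<phi>) (y, \<phi> y)"
  then obtain ps ts where ps: "ps \<longlonglongrightarrow> p" and t0: "\<And>k. 0 < ts k" and t: "ts \<longlonglongrightarrow> (0::real)"
    and mem: "\<And>k::nat. (y, \<phi> y) + ts k *\<^sub>R ps k \<in> epigraph UNIV \<phi>"
    unfolding tangent_cone_def by blast
  have le: "\<phi> (y + ts k *\<^sub>R fst (ps k)) \<le> \<phi> y + ts k * snd (ps k)" for k
    using mem[of k] by (cases "ps k") (simp add: mem_epigraph)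
  have v: "(\<lambda>k. fst (ps k)) \<longlonglongrightarrow> fst p" and b: "(\<lambda>k. snd (ps k)) \<longlonglongrightarrow> snd p"
    using ps by (auto intro: tendsto_intros)
  have yk: "(\<lambda>k. y + ts k *\<^sub>R fst (ps k)) \<longlonglongrightarrow> y"
    using tendsto_add[OF tendsto_const[of y] tendsto_scaleR[OF t v]] by simp
  have ineq: "\<xi> \<bullet> fst p - \<epsilon> * norm (fst p) \<le> snd p" if e: "\<epsilon> > 0" for \<epsilon>
  proof (rule tendsto_le[OF sequentially_bot b])
    show "(\<lambda>k. \<xi> \<bullet> fst (ps k) - \<epsilon> * norm (fst (ps k))) \<longlonglongrightarrow> \<xi> \<bullet> fst p - \<epsilon> * norm (fst p)"
      by (intro tendsto_intros v)
    have "\<forall>\<^sub>F u in nhds y. \<phi> y + \<xi> \<bullet> (u - y) - \<epsilon> * norm (u - y) \<le> \<phi> u"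
      using assms e unfolding frechet_subgradient_def by blast
    from eventually_compose_filterlim[OF this yk]
    show "\<forall>\<^sub>F k in sequentially. \<xi> \<bullet> fst (ps k) - \<epsilon> * norm (fst (ps k)) \<le> snd (ps k)"
    proof eventually_elim
      case (elim k)
      have "ts k * (\<xi> \<bullet> fst (ps k) - \<epsilon> * norm (fst (ps k))) \<le> ts k * snd (ps k)"
        using elim le[of k] t0[of k] by (simp add: algebra_simps)
      then show ?case using t0[of k] by simp
    qed
  qed
  have "\<xi> \<bullet> fst p \<le> snd p"
  proof (rule field_le_epsilon)
    fix e :: real assume e: "e > 0"
    have "e / (norm (fst p) + 1) * norm (fst p) \<le> e"
      using e norm_ge_zero[of "fst p"]
      by (simp add: pos_divide_le_eq add_nonneg_pos mult_left_mono)
    then show "\<xi> \<bullet> fst p \<le> snd p + e"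
      using ineq[of "e / (norm (fst p) + 1)"] e
      by (simp add: add_nonneg_pos)
  qed
  then show "(\<xi>, - 1) \<bullet> p \<le> 0"
    by (cases p) (simp add: inner_prod_def)
qed

lemma frechet_subgradient_subdiff:
  assumes "frechet_subgradient \<phi> y \<xi>"
  shows "\<xi> \<in> subdiff \<phi> y"
  unfolding subdiff_def
  using regular_normal_imp_normal[OF frechet_subgradient_regular_normal[OF assms]] by simp

text \<open>Squaring the distance inequality along a tangent sequence leaves a linear and a
  quadratic term. The quadratic one retains a factor \<open>ts k\<close> after division, so only the
  linear one survives in the limit.\<close>

lemma closest_point_regular_normal:
  assumes z: "z \<in> \<Omega>" and min: "\<And>v. v \<in> \<Omega> \<Longrightarrow> norm (p - z) \<le> norm (p - v)" and m: "0 \<le> m"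
  shows "m *\<^sub>R (p - z) \<in> regular_normal_cone \<Omega> z"
  unfolding regular_normal_cone_def mem_Collect_eq
proof (intro conjI ballI)
  fix v assume "v \<in> tangent_cone \<Omega> z"
  then obtain vs ts where vs: "vs \<longlonglongrightarrow> v" and t0: "\<And>k. 0 < ts k" and t: "ts \<longlonglongrightarrow> (0::real)"
    and mem: "\<And>k::nat. z + ts k *\<^sub>R vs k \<in> \<Omega>"
    unfolding tangent_cone_def by blast
  have "2 * ((p - z) \<bullet> vs k) \<le> ts k * (vs k \<bullet> vs k)" for k
  proof -
    have "(norm (p - z))\<^sup>2 \<le> (norm ((p - z) - ts k *\<^sub>R vs k))\<^sup>2"
      using min[OF mem[of k]] by (intro power_mono) (auto simp: algebra_simps)
    then have "ts k * (2 * ((p - z) \<bullet> vs k)) \<le> ts k * (ts k * (vs k \<bullet> vs k))"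
      unfolding power2_norm_eq_inner by (simp add: algebra_simps inner_commute)
    then show ?thesis using t0[of k] by simp
  qed
  moreover have "(\<lambda>k. 2 * ((p - z) \<bullet> vs k)) \<longlonglongrightarrow> 2 * ((p - z) \<bullet> v)"
    by (intro tendsto_intros vs)
  moreover have "(\<lambda>k. ts k * (vs k \<bullet> vs k)) \<longlonglongrightarrow> 0 * (v \<bullet> v)"
    by (intro tendsto_intros vs t)
  ultimately have "2 * ((p - z) \<bullet> v) \<le> 0 * (v \<bullet> v)"
    using LIMSEQ_le by blast
  then show "m *\<^sub>R (p - z) \<bullet> v \<le> 0"
    using m by (simp add: mult_le_0_iff)
qed (rule z)

section \<open>Stability of subgradients\<close>

text \<open>The quadratic term moves the minimizer by at most \<open>\<epsilon> / M\<close>, so its gradient there has norm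
  at most \<open>2 * \<epsilon>\<close> while \<open>M\<close> is still free to be large.\<close>

lemma approximate_subgradient:
  fixes \<phi> :: "'a::euclidean_space \<Rightarrow> real"
  assumes cont: "continuous_on UNIV \<phi>" and e: "0 < \<epsilon>"
    and sub: "\<forall>\<^sub>F u in nhds y. \<phi> y + \<xi> \<bullet> (u - y) - \<epsilon> * norm (u - y) \<le> \<phi> u" and r: "0 < r"
  obtains y' \<xi>' where "norm (y' - y) < r" "norm (\<xi>' - \<xi>) \<le> 2 * \<epsilon>" "frechet_subgradient \<phi> y' \<xi>'"
proof -
  obtain q where q: "q > 0"
    and sq: "\<And>u. dist u y < q \<Longrightarrow> \<phi> y + \<xi> \<bullet> (u - y) - \<epsilon> * norm (u - y) \<le> \<phi> u"
    using sub unfolding eventually_nhds_metric by blast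
  \<comment> \<open>Halving puts the closed ball strictly inside both prescribed radii. The choice
    of \<open>M\<close> then gives \<open>\<epsilon> / M = \<rho> / 2\<close>, so the minimizer over
    the ball is interior.\<close>
  define \<rho> where "\<rho> = min q r / 2"
  define M where "M = 2 * \<epsilon> / \<rho>"
  have rho: "0 < \<rho>" "\<rho> < q" "\<rho> < r" using q r by (auto simp: \<rho>_def)
  have M: "0 < M" "\<epsilon> < M * \<rho>" using rho e by (auto simp: M_def)
  define h where "h u = \<phi> u - \<xi> \<bullet> u + M * (norm (u - y))\<^sup>2" for u
  have "continuous_on (cball y \<rho>) h"
    unfolding h_def by (intro continuous_intros continuous_on_subset[OF cont]) auto
  moreover have "cball y \<rho> \<noteq> {}" using rho by auto
  ultimately obtain y' where y': "y' \<in> cball y \<rho>" and min: "\<And>u. u \<in> cball y \<rho> \<Longrightarrow> h y' \<le> h u"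
    using continuous_attains_inf[OF compact_cball] by metis
  have ny: "norm (y' - y) \<le> \<rho>" using y' by (simp add: dist_norm norm_minus_commute)
  have "h y' \<le> h y" using min rho by simp
  moreover have "\<phi> y + \<xi> \<bullet> (y' - y) - \<epsilon> * norm (y' - y) \<le> \<phi> y'"
    using ny rho by (intro sq) (simp add: dist_norm)
  ultimately have "norm (y' - y) * (M * norm (y' - y)) \<le> norm (y' - y) * \<epsilon>"
    unfolding h_def by (simp add: algebra_simps power2_eq_square)
  then have My: "M * norm (y' - y) \<le> \<epsilon>"
    using e by (cases "y' = y") auto
  have lt: "norm (y' - y) < \<rho>"
  proof (rule ccontr)
    assume "\<not> ?thesis"
    then have "M * \<rho> \<le> M * norm (y' - y)" using M(1) by (intro mult_left_mono) auto
    then show False using My M(2) by linarith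
  qed
  \<comment> \<open>The slope \<open>\<xi>\<close> corrected by the gradient of the quadratic term
    at \<open>y'\<close>, as stationarity of \<open>h\<close> at an interior minimizer
    dictates.\<close>
  define \<xi>' where "\<xi>' = \<xi> - (2 * M) *\<^sub>R (y' - y)"
  have "frechet_subgradient \<phi> y' \<xi>'"
    unfolding frechet_subgradient_def
  proof (intro allI impI)
    fix \<epsilon>' :: real assume e': "\<epsilon>' > 0"
    show "\<forall>\<^sub>F u in nhds y'. \<phi> y' + \<xi>' \<bullet> (u - y') - \<epsilon>' * norm (u - y') \<le> \<phi> u"
      unfolding eventually_nhds_metric
    proof (intro exI conjI allI impI)
      \<comment> \<open>The first radius keeps \<open>u\<close> in the ball on which
        \<open>y'\<close> is minimal; the second lets \<open>\<epsilon>' * norm (u - y')\<close>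
        absorb the remainder \<open>M * (norm (u - y'))\<^sup>2\<close>.\<close>
      show "0 < min (\<rho> - norm (y' - y)) (\<epsilon>' / M)" using lt e' M by simp
      fix u assume u: "dist u y' < min (\<rho> - norm (y' - y)) (\<epsilon>' / M)"
      have "norm (u - y) \<le> norm (u - y') + norm (y' - y)"
        using norm_triangle_ineq[of "u - y'" "y' - y"] by simp
      then have "u \<in> cball y \<rho>" using u by (simp add: dist_norm norm_minus_commute)
      from min[OF this]
      have hle: "\<phi> y' - \<xi> \<bullet> y' + M * (norm (y' - y))\<^sup>2 \<le> \<phi> u - \<xi> \<bullet> u + M * (norm (u - y))\<^sup>2"
        unfolding h_def .
      have "(norm (u - y))\<^sup>2 = (norm (y' - y))\<^sup>2 + 2 * ((y' - y) \<bullet> (u - y')) + (norm (u - y'))\<^sup>2"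
        unfolding power2_norm_eq_inner by (simp add: algebra_simps inner_commute)
      from arg_cong[OF this, of "\<lambda>a. M * a"] have M2: "M * (norm (u - y))\<^sup>2
          = M * (norm (y' - y))\<^sup>2 + 2 * M * ((y' - y) \<bullet> (u - y')) + M * (norm (u - y'))\<^sup>2"
        by (simp only: distrib_left mult.left_commute mult.assoc)
      have "M * norm (u - y') \<le> \<epsilon>'"
        using u M by (simp add: dist_norm pos_less_divide_eq mult.commute less_imp_le)
      then have "M * (norm (u - y'))\<^sup>2 \<le> \<epsilon>' * norm (u - y')"
        unfolding power2_eq_square by (simp add: mult_right_mono flip: mult.assoc)
      moreover have "\<xi>' \<bullet> (u - y') = \<xi> \<bullet> u - \<xi> \<bullet> y' - 2 * M * ((y' - y) \<bullet> (u - y'))"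
        unfolding \<xi>'_def by (simp add: algebra_simps)
      ultimately show "\<phi> y' + \<xi>' \<bullet> (u - y') - \<epsilon>' * norm (u - y') \<le> \<phi> u"
        using hle M2 by linarith
    qed
  qed
  moreover have "norm (\<xi>' - \<xi>) \<le> 2 * \<epsilon>"
    using My M by (simp add: \<xi>'_def)
  moreover have "norm (y' - y) < r" using lt rho by simp
  ultimately show thesis using that by blast
qed

section \<open>Local Lipschitz continuity and directional difference quotients\<close>

lemma locally_lipschitz_obtain:
  assumes "locally_lipschitz F"
  obtains r L where "0 < r" "0 \<le> L"
    "\<And>u v. u \<in> ball x r \<Longrightarrow> v \<in> ball x r \<Longrightarrow> norm (F u - F v) \<le> L * norm (u - v)"
proof -
  obtain r L where "0 < r" and L: "L-lipschitz_on (ball x r) F"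
    using assms unfolding locally_lipschitz_def by blast
  then show thesis
    using that[of r L] lipschitz_on_nonneg[OF L] lipschitz_onD[OF L] by (simp add: dist_norm)
qed

lemma locally_lipschitz_continuous:
  assumes "locally_lipschitz F"
  shows "continuous_on UNIV F"
  unfolding continuous_on_eq_continuous_at[OF open_UNIV]
proof
  fix x
  obtain r L where r: "0 < r" and L: "L-lipschitz_on (ball x r) F"
    using assms unfolding locally_lipschitz_def by blast
  show "isCont F x"
    using lipschitz_on_continuous_on[OF L] r
    by (simp add: continuous_on_eq_continuous_at)
qed

lemma directionally_differentiable_tendsto:
  assumes "directionally_differentiable F"
  shows "((\<lambda>t. (F (x + t *\<^sub>R d) - F x) /\<^sub>R t) \<longlongrightarrow> dir_deriv F x d) (at_right 0)"
proof -
  obtain l where l: "((\<lambda>t. (F (x + t *\<^sub>R d) - F x) /\<^sub>R t) \<longlongrightarrow> l) (at_right 0)"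
    using assms unfolding directionally_differentiable_def by blast
  then have "dir_deriv F x d = l"
    unfolding dir_deriv_def by (intro tendsto_Lim) auto
  then show ?thesis using l by simp
qed

text \<open>Directional differentiability controls only a fixed direction. By the Lipschitz bound,
  replacing \<open>ws k\<close> by \<open>w\<close> costs at most \<open>L * norm (ws k - w)\<close>
  in the quotient, so the directions may vary.\<close>

lemma difference_quotient_tendsto:
  assumes dd: "directionally_differentiable F" and ll: "locally_lipschitz F"
    and w: "ws \<longlonglongrightarrow> w" and t0: "\<And>k::nat. 0 < ts k" and t: "ts \<longlonglongrightarrow> (0::real)"
  shows "(\<lambda>k. (F (x + ts k *\<^sub>R ws k) - F x) /\<^sub>R ts k) \<longlonglongrightarrow> dir_deriv F x w"
proof -
  obtain r L where r: "0 < r" and L: "0 \<le> L"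
    and lip: "\<And>u v. u \<in> ball x r \<Longrightarrow> v \<in> ball x r \<Longrightarrow> norm (F u - F v) \<le> L * norm (u - v)"
    using locally_lipschitz_obtain[OF ll] by metis
  have tr: "filterlim ts (at_right 0) sequentially"
    using t t0 by (auto simp: filterlim_at less_imp_neq[symmetric])
  have main: "(\<lambda>k. (F (x + ts k *\<^sub>R w) - F x) /\<^sub>R ts k) \<longlonglongrightarrow> dir_deriv F x w"
    using filterlim_compose[OF directionally_differentiable_tendsto[OF dd] tr] .
  have near: "\<forall>\<^sub>F k in sequentially. x + ts k *\<^sub>R v k \<in> ball x r" if "v \<longlonglongrightarrow> w" for v
  proof -
    have "(\<lambda>k. x + ts k *\<^sub>R v k) \<longlonglongrightarrow> x + 0 *\<^sub>R w" by (intro tendsto_intros that t)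
    then show ?thesis using r by (intro topological_tendstoD) auto
  qed
  have "(\<lambda>k. (F (x + ts k *\<^sub>R ws k) - F (x + ts k *\<^sub>R w)) /\<^sub>R ts k) \<longlonglongrightarrow> 0"
  proof (rule Lim_null_comparison)
    show "(\<lambda>k. L * norm (ws k - w)) \<longlonglongrightarrow> 0"
      using tendsto_mult_right_zero[OF tendsto_norm_zero[OF LIM_zero[OF w]]] by simp
    show "\<forall>\<^sub>F k in sequentially.
        norm ((F (x + ts k *\<^sub>R ws k) - F (x + ts k *\<^sub>R w)) /\<^sub>R ts k) \<le> L * norm (ws k - w)"
      using near[OF w] near[OF tendsto_const]
    proof eventually_elim
      case (elim k)
      from lip[OF this]
      have "norm (F (x + ts k *\<^sub>R ws k) - F (x + ts k *\<^sub>R w)) \<le> L * (ts k * norm (ws k - w))"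
        using t0[of k] by (simp flip: scaleR_diff_right)
      then show ?case using t0[of k] by (simp add: pos_divide_le_eq divide_inverse[symmetric] mult_ac flip: divide_inverse_commute)
    qed
  qed
  from tendsto_add[OF this main] show ?thesis
    by (simp flip: scaleR_add_right)
qed

text \<open>Each \<open>\<xi>s k\<close> belongs to the scalarization by \<open>ls k\<close>,
  whereas the epigraph in the conclusion is that of the limit \<open>\<mu>\<close>. Replacing
  \<open>ls k\<close> by \<open>\<mu>\<close> changes slopes by at most
  \<open>L * norm (ls k - \<mu>)\<close>, and the resulting approximate subgradients become exact
  ones at slightly moved points.\<close>

lemma multiplier_limit_dir_subdiff:
  fixes F :: "'a::euclidean_space \<Rightarrow> 'b::euclidean_space"
  assumes dd: "directionally_differentiable F" and ll: "locally_lipschitz F"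
    and w: "ws \<longlonglongrightarrow> w" and t0: "\<And>k::nat. 0 < ts k" and t: "ts \<longlonglongrightarrow> (0::real)"
    and l: "ls \<longlonglongrightarrow> \<mu>" and xi: "\<xi>s \<longlonglongrightarrow> \<xi>"
    and sub: "\<And>k. frechet_subgradient (scalarization (ls k) F) (x + ts k *\<^sub>R ws k) (\<xi>s k)"
  shows "\<xi> \<in> dir_subdiff (scalarization \<mu> F) x w"
proof -
  define \<phi> where "\<phi> = scalarization \<mu> F"
  obtain r L where r: "0 < r" and L: "0 \<le> L"
    and lip: "\<And>u v. u \<in> ball x r \<Longrightarrow> v \<in> ball x r \<Longrightarrow> norm (F u - F v) \<le> L * norm (u - v)"
    using locally_lipschitz_obtain[OF ll] by metis
  define y where "y k = x + ts k *\<^sub>R ws k" for k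
  \<comment> \<open>The first summand is the tolerance taken in the subgradient inequality and keeps
    \<open>e k\<close> positive when \<open>ls k = \<mu>\<close>; the second is the slope
    error.\<close>
  define e where "e k = inverse (real (Suc k)) + L * norm (ls k - \<mu>)" for k
  have e0: "0 < e k" for k
    unfolding e_def using L by (intro add_pos_nonneg) auto
  have e: "e \<longlonglongrightarrow> 0"
    unfolding e_def
    using tendsto_add[OF LIMSEQ_inverse_real_of_nat
        tendsto_mult_right_zero[OF tendsto_norm_zero[OF LIM_zero[OF l]]]] by simp
  have "y \<longlonglongrightarrow> x + 0 *\<^sub>R w" unfolding y_def by (intro tendsto_intros w t)
  then have "\<forall>\<^sub>F k in sequentially. y k \<in> ball x r"
    using r by (intro topological_tendstoD) auto
  then obtain K where K: "\<And>k. k \<ge> K \<Longrightarrow> y k \<in> ball x r"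
    unfolding eventually_sequentially by blast
  have cont: "continuous_on UNIV \<phi>"
    unfolding \<phi>_def by (intro continuous_intros locally_lipschitz_continuous[OF ll])
  \<comment> \<open>The displacement is small relative to \<open>ts k\<close>, not just small, so
    that the directions from \<open>x\<close> to the moved points keep the limit
    \<open>w\<close>.\<close>
  have "\<exists>Y \<Xi>. norm (Y - y k) < ts k * inverse (real (Suc k)) \<and> norm (\<Xi> - \<xi>s k) \<le> 2 * e k \<and>
      frechet_subgradient \<phi> Y \<Xi>" if k: "k \<ge> K" for k
  proof -
    have "\<forall>\<^sub>F u in nhds (y k). ls k \<bullet> F (y k) + \<xi>s k \<bullet> (u - y k) - inverse (real (Suc k)) * norm (u - y k)
        \<le> ls k \<bullet> F u"
      using sub[of k] unfolding frechet_subgradient_def y_def by simp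
    moreover have "\<forall>\<^sub>F u in nhds (y k). u \<in> ball x r"
      using K[OF k] by (intro eventually_nhds_in_open) auto
    ultimately have "\<forall>\<^sub>F u in nhds (y k). \<phi> (y k) + \<xi>s k \<bullet> (u - y k) - e k * norm (u - y k) \<le> \<phi> u"
    proof eventually_elim
      case (elim u)
      have "(ls k - \<mu>) \<bullet> (F u - F (y k)) \<le> norm (ls k - \<mu>) * norm (F u - F (y k))"
        by (rule norm_cauchy_schwarz)
      also have "\<dots> \<le> norm (ls k - \<mu>) * (L * norm (u - y k))"
        using lip[OF elim(2) K[OF k]] by (intro mult_left_mono) auto
      finally show ?case
        using elim(1) unfolding \<phi>_def e_def by (simp add: algebra_simps)
    qed
    from approximate_subgradient[OF cont e0 this, of "ts k * inverse (real (Suc k))"]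
    show ?thesis using t0[of k] by (metis mult_pos_pos inverse_positive_iff_positive of_nat_0_less_iff zero_less_Suc)
  qed
  then obtain Y \<Xi> where Y: "\<And>k. k \<ge> K \<Longrightarrow> norm (Y k - y k) < ts k * inverse (real (Suc k))"
    and \<Xi>: "\<And>k. k \<ge> K \<Longrightarrow> norm (\<Xi> k - \<xi>s k) \<le> 2 * e k"
    and Fs: "\<And>k. k \<ge> K \<Longrightarrow> frechet_subgradient \<phi> (Y k) (\<Xi> k)"
    by metis
  define W where "W k = (Y k - x) /\<^sub>R ts k" for k
  have Yx: "x + ts k *\<^sub>R W k = Y k" for k
    using t0[of k] by (simp add: W_def)
  have "(\<lambda>k. W k - ws k) \<longlonglongrightarrow> 0"
  proof (rule Lim_null_comparison[OF _ LIMSEQ_inverse_real_of_nat])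
    show "\<forall>\<^sub>F k in sequentially. norm (W k - ws k) \<le> inverse (real (Suc k))"
      unfolding eventually_sequentially
    proof (intro exI allI impI)
      fix k assume "K \<le> k"
      have "W k - ws k = (Y k - y k) /\<^sub>R ts k"
        using t0[of k] by (simp add: W_def y_def algebra_simps)
      then show "norm (W k - ws k) \<le> inverse (real (Suc k))"
        using Y[OF \<open>K \<le> k\<close>] t0[of k] by (simp add: pos_divide_le_eq mult_ac flip: divide_inverse_commute)
    qed
  qed
  from tendsto_add[OF this w] have W: "W \<longlonglongrightarrow> w" by simp
  have "(\<lambda>k. \<Xi> k - \<xi>s k) \<longlonglongrightarrow> 0"
  proof (rule Lim_null_comparison)
    show "(\<lambda>k. 2 * e k) \<longlonglongrightarrow> 0" using tendsto_mult_right_zero[OF e] .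
    show "\<forall>\<^sub>F k in sequentially. norm (\<Xi> k - \<xi>s k) \<le> 2 * e k"
      using \<Xi> unfolding eventually_sequentially by blast
  qed
  from tendsto_add[OF this xi] have \<Xi>lim: "\<Xi> \<longlonglongrightarrow> \<xi>" by simp
  \<comment> \<open>This height makes \<open>ts k *\<^sub>R (W k, q k)\<close> lead from
    \<open>(x, \<phi> x)\<close> exactly onto the graph, where the regular normals are
    known.\<close>
  define q where "q k = (\<phi> (Y k) - \<phi> x) / ts k" for k
  have "(\<lambda>k. \<mu> \<bullet> ((F (x + ts k *\<^sub>R W k) - F x) /\<^sub>R ts k)) \<longlonglongrightarrow> \<mu> \<bullet> dir_deriv F x w"
    by (intro tendsto_intros difference_quotient_tendsto dd ll W t t0)
  then have q: "q \<longlonglongrightarrow> \<mu> \<bullet> dir_deriv F x w"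
    unfolding Yx q_def \<phi>_def by (simp add: inner_diff_right divide_inverse mult.commute)
  have "((\<lambda>t. \<mu> \<bullet> ((F (x + t *\<^sub>R w) - F x) /\<^sub>R t)) \<longlongrightarrow> \<mu> \<bullet> dir_deriv F x w) (at_right 0)"
    by (intro tendsto_intros directionally_differentiable_tendsto dd)
  then have "dir_deriv \<phi> x w = \<mu> \<bullet> dir_deriv F x w"
    unfolding dir_deriv_def[of \<phi>] by (intro tendsto_Lim) (auto simp: \<phi>_def inner_diff_right)
  with q have "(\<lambda>k. (W k, q k)) \<longlonglongrightarrow> (w, dir_deriv \<phi> x w)"
    by (intro tendsto_Pair W) simp
  \<comment> \<open>\<open>Y\<close> and \<open>\<Xi>\<close> are controlled only from index
    \<open>K\<close> on, while the directional normal cone asks for regular normals at every index;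
    hence the shift.\<close>
  then have p: "(\<lambda>k. (W (k + K), q (k + K))) \<longlonglongrightarrow> (w, dir_deriv \<phi> x w)"
    using LIMSEQ_ignore_initial_segment[of "\<lambda>k. (W k, q k)"] by blast
  have "(\<lambda>k. (\<Xi> k, - 1)) \<longlonglongrightarrow> (\<xi>, - 1 :: real)"
    by (intro tendsto_intros \<Xi>lim)
  then have g: "(\<lambda>k. (\<Xi> (k + K), - 1)) \<longlonglongrightarrow> (\<xi>, - 1 :: real)"
    using LIMSEQ_ignore_initial_segment[of "\<lambda>k. (\<Xi> k, - 1)"] by blast
  have mem: "(\<Xi> (k + K), - 1) \<in> regular_normal_cone (epigraph UNIV \<phi>)
      ((x, \<phi> x) + ts (k + K) *\<^sub>R (W (k + K), q (k + K)))" for k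
  proof -
    have "(x, \<phi> x) + ts (k + K) *\<^sub>R (W (k + K), q (k + K)) = (Y (k + K), \<phi> (Y (k + K)))"
      using t0[of "k + K"] by (simp add: Yx q_def)
    then show ?thesis
      using frechet_subgradient_regular_normal[OF Fs[of "k + K"]] by simp
  qed
  have "(x, \<phi> x) \<in> epigraph UNIV \<phi>" by (simp add: mem_epigraph)
  then have "(\<xi>, - 1) \<in> dir_normal_cone (epigraph UNIV \<phi>) (x, \<phi> x) (w, dir_deriv \<phi> x w)"
    unfolding dir_normal_cone_def mem_Collect_eq
    using p g mem t0 LIMSEQ_ignore_initial_segment[OF t, of K]
    by (intro conjI exI[of _ "\<lambda>k. (W (k + K), q (k + K))"] exI[of _ "\<lambda>k. ts (k + K)"]
        exI[of _ "\<lambda>k. (\<Xi> (k + K), - 1)"]) auto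
  then show ?thesis
    unfolding dir_subdiff_def \<phi>_def by simp
qed

section \<open>Penalization\<close>

text \<open>The proximal weight \<open>s\<^sup>2 / t\<close> balances both demands on the excess \<open>s^4 * t\<close> of \<open>xb\<close>: the minimizer
  stays within \<open>o(t)\<close> of \<open>xb\<close>, and the gradient of the proximal term, of order \<open>s^3\<close>, vanishes.\<close>

lemma penalized_minimizer:
  fixes F :: "'a::euclidean_space \<Rightarrow> 'b::euclidean_space" and f :: "'a \<Rightarrow> real"
  assumes fd: "\<And>u. f differentiable at u" and ll: "locally_lipschitz F" and cl: "closed \<Gamma>"
    and xb: "xb \<in> F -` \<Gamma>" and low: "\<And>u. u \<in> F -` \<Gamma> \<Longrightarrow> u \<in> cball xb t \<Longrightarrow> a \<le> f u"
    and up: "f xb \<le> a + s ^ 4 * t" and s: "0 < s" "2 * s < 1" and t: "0 < t"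
  obtains y z m where "M < m" "0 < m" "z \<in> \<Gamma>" "norm (y - xb) \<le> 2 * s * t"
    "f y + m / 2 * (norm (F y - z))\<^sup>2 \<le> f xb" "m * (norm (F y - z))\<^sup>2 \<le> 4 * s ^ 4 * t"
    "m *\<^sub>R (F y - z) \<in> regular_normal_cone \<Gamma> z"
    "frechet_subgradient (scalarization (m *\<^sub>R (F y - z)) F) y (- grad f y - (2 * s\<^sup>2 / t) *\<^sub>R (y - xb))"
proof -
  define c where "c = s\<^sup>2 / t"
  have c: "0 < c" using s t by (simp add: c_def)
  have ne: "\<Gamma> \<noteq> {}" using xb by auto
  have contf: "continuous_on UNIV f"
    using fd by (simp add: differentiable_imp_continuous_within continuous_on_eq_continuous_within)
  have contF: "continuous_on UNIV F" by (rule locally_lipschitz_continuous[OF ll])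
  \<comment> \<open>Minimizing over \<open>z\<close> first turns the penalty into a squared distance
    to \<open>\<Gamma>\<close> and leaves a continuous problem on a compact ball.\<close>
  define G where "G u = infdist (F u) \<Gamma>" for u
  define h where "h m u = f u + c * (norm (u - xb))\<^sup>2 + m / 2 * (G u)\<^sup>2" for m u
  have contG: "continuous_on UNIV G"
    unfolding G_def by (intro continuous_intros contF)
  have conth: "continuous_on (cball xb t) (h m)" for m
    unfolding h_def by (intro continuous_intros continuous_on_subset[OF contf] continuous_on_subset[OF contG]) auto
  have Gxb: "G xb = 0" using xb by (simp add: G_def)
  have "cball xb t \<noteq> {}" using t by auto
  then have "\<exists>y\<in>cball xb t. \<forall>u\<in>cball xb t. h m y \<le> h m u" for m
    using continuous_attains_inf[OF compact_cball _ conth[of m]] by blast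
  then obtain Y where Ycb: "\<And>m. Y m \<in> cball xb t"
    and Ymin: "\<And>m u. u \<in> cball xb t \<Longrightarrow> h m (Y m) \<le> h m u" by metis
  have Yxb: "f (Y m) + c * (norm (Y m - xb))\<^sup>2 + m / 2 * (G (Y m))\<^sup>2 \<le> f xb" for m
    using Ymin[of xb m] t Gxb by (simp add: h_def)
  have st: "0 < s ^ 4 * t" using s t by simp
  \<comment> \<open>Otherwise minimizers for parameters tending to infinity would cluster at a point
    that is feasible, because the penalty terms stay bounded along the convergent subsequence, yet
    has a value below \<open>a\<close>, against \<open>low\<close>.\<close>
  have "\<exists>m. M < m \<and> 0 < m \<and> a - s ^ 4 * t < f (Y m)"
  proof (rule ccontr)
    assume no: "\<not> ?thesis"
    define m where "m n = real n + 1 + \<bar>M\<bar>" for n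
    have m: "M < m n" "0 < m n" for n by (auto simp: m_def)
    have bad: "f (Y (m n)) \<le> a - s ^ 4 * t" for n
      using no m[of n] by (metis not_less)
    obtain yl r where yl: "yl \<in> cball xb t" and r: "strict_mono r"
      and lim: "((\<lambda>n. Y (m n)) \<circ> r) \<longlonglongrightarrow> yl"
      using seq_compactE[OF compact_imp_seq_compact[OF compact_cball], of "\<lambda>n. Y (m n)" xb t] Ycb
      by metis
    have lim': "(\<lambda>n. Y (m (r n))) \<longlonglongrightarrow> yl" using lim by (simp add: o_def)
    have fl: "(\<lambda>n. f (Y (m (r n)))) \<longlonglongrightarrow> f yl"
      using continuous_on_tendsto_compose[OF contf lim'] by simp
    have Gl: "(\<lambda>n. G (Y (m (r n)))) \<longlonglongrightarrow> G yl"
      using continuous_on_tendsto_compose[OF contG lim'] by simp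
    have rinf: "filterlim (\<lambda>n. m (r n)) at_top sequentially"
    proof (rule filterlim_at_top_mono)
      show "filterlim (\<lambda>n. real (r n)) at_top sequentially"
        using filterlim_compose[OF filterlim_real_sequentially filterlim_subseq[OF r]] .
    qed (simp add: m_def)
    have "(\<lambda>n. 2 * (f xb - f (Y (m (r n)))) * inverse (m (r n))) \<longlonglongrightarrow> 2 * (f xb - f yl) * 0"
      by (intro tendsto_intros fl tendsto_inverse_0_at_top rinf)
    moreover have "(\<lambda>n. (G (Y (m (r n))))\<^sup>2) \<longlonglongrightarrow> (G yl)\<^sup>2"
      by (intro tendsto_intros Gl)
    moreover have "(G (Y (m (r n))))\<^sup>2 \<le> 2 * (f xb - f (Y (m (r n)))) * inverse (m (r n))" for n
    proof -
      have "0 \<le> c * (norm (Y (m (r n)) - xb))\<^sup>2" using c by simp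
      then have "m (r n) * (G (Y (m (r n))))\<^sup>2 \<le> 2 * (f xb - f (Y (m (r n))))"
        using Yxb[of "m (r n)"] by simp
      then show ?thesis
        using m(2)[of "r n"] by (simp add: field_simps)
    qed
    ultimately have "(G yl)\<^sup>2 \<le> 2 * (f xb - f yl) * 0"
      using LIMSEQ_le by blast
    then have "G yl = 0" by simp
    then have "yl \<in> F -` \<Gamma>"
      using in_closed_iff_infdist_zero[OF cl ne] by (simp add: G_def)
    then have "a \<le> f yl" using low yl by blast
    moreover have "f yl \<le> a - s ^ 4 * t"
      using fl bad by (intro LIMSEQ_le_const2) auto
    ultimately show False using st by simp
  qed
  then obtain m where m: "M < m" "0 < m" and fy: "a - s ^ 4 * t < f (Y m)" by blast
  define y where "y = Y m"
  obtain z where z: "z \<in> \<Gamma>" and Gz: "G y = dist (F y) z"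
    using infdist_attains_inf[OF cl ne] unfolding G_def by metis
  define \<mu> where "\<mu> = m *\<^sub>R (F y - z)"
  have main: "f y + c * (norm (y - xb))\<^sup>2 + m / 2 * (norm (F y - z))\<^sup>2 \<le> f xb"
    using Yxb[of m] unfolding y_def[symmetric] Gz dist_norm .
  have cn: "0 \<le> c * (norm (y - xb))\<^sup>2" and mn: "0 \<le> m / 2 * (norm (F y - z))\<^sup>2"
    using c m by auto
  \<comment> \<open>\<open>f xb\<close> exceeds \<open>a\<close> by at most \<open>s ^ 4 * t\<close>
    and \<open>f y\<close> undercuts it by less than that, so the proximal and the penalty term
    share a budget of \<open>2 * s ^ 4 * t\<close>.\<close>
  have C1: "c * (norm (y - xb))\<^sup>2 \<le> 2 * s ^ 4 * t"
    using main mn up fy unfolding y_def[symmetric] by linarith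
  have C2: "m * (norm (F y - z))\<^sup>2 \<le> 4 * s ^ 4 * t"
    using main cn up fy unfolding y_def[symmetric] by linarith
  have near: "norm (y - xb) \<le> 2 * s * t"
  proof (rule power2_le_imp_le)
    have "s\<^sup>2 * (norm (y - xb))\<^sup>2 \<le> s\<^sup>2 * (2 * s\<^sup>2 * t\<^sup>2)"
      using C1 t unfolding c_def by (simp add: field_simps power_def numeral_eq_Suc)
    then have "(norm (y - xb))\<^sup>2 \<le> 2 * s\<^sup>2 * t\<^sup>2" using s by simp
    also have "\<dots> \<le> (2 * s * t)\<^sup>2" by (simp add: power_mult_distrib)
    finally show "(norm (y - xb))\<^sup>2 \<le> (2 * s * t)\<^sup>2" .
  qed (use s t in simp)
  \<comment> \<open>Here \<open>2 * s < 1\<close> makes \<open>y\<close> interior to the ball, so it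
    is minimal against all nearby \<open>u\<close>.\<close>
  have "2 * s * t < t" using s t by simp
  then have yin: "y \<in> ball xb t" using near by (simp add: dist_norm norm_minus_commute)
  have normal: "\<mu> \<in> regular_normal_cone \<Gamma> z"
    unfolding \<mu>_def
  proof (rule closest_point_regular_normal[OF z])
    show "norm (F y - z) \<le> norm (F y - v)" if "v \<in> \<Gamma>" for v
      using infdist_le[OF that, of "F y"] Gz unfolding G_def dist_norm by simp
  qed (use m in simp)
  obtain r L where r: "0 < r" and L: "0 \<le> L"
    and lip: "\<And>u v. u \<in> ball y r \<Longrightarrow> v \<in> ball y r \<Longrightarrow> norm (F u - F v) \<le> L * norm (u - v)"
    using locally_lipschitz_obtain[OF ll] by metis
  define C where "C = c + m / 2 * L\<^sup>2"
  have C: "0 < C" using c m by (simp add: C_def add_pos_nonneg)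
  have "frechet_subgradient (scalarization \<mu> F) y (- grad f y - (2 * c) *\<^sub>R (y - xb))"
    unfolding frechet_subgradient_def
  proof (intro allI impI)
    fix \<epsilon> :: real assume e: "0 < \<epsilon>"
    have "(f has_derivative (\<lambda>h. h \<bullet> grad f y)) (at y)"
      using GDERIV_grad[OF fd] unfolding gderiv_def .
    then obtain q where q: "0 < q" and
      fq: "\<And>u. norm (u - y) < q \<Longrightarrow> norm (f u - f y - (u - y) \<bullet> grad f y) \<le> \<epsilon> / 2 * norm (u - y)"
      using e unfolding has_derivative_at_alt by (metis half_gt_zero)
    show "\<forall>\<^sub>F u in nhds y. \<mu> \<bullet> F y + (- grad f y - (2 * c) *\<^sub>R (y - xb)) \<bullet> (u - y) - \<epsilon> * norm (u - y)
        \<le> \<mu> \<bullet> F u"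
      unfolding eventually_nhds_metric
    proof (intro exI conjI allI impI)
      \<comment> \<open>The radii serve, in this order, the expansion of \<open>f\<close>, the
        Lipschitz bound, the absorption of the quadratic terms collected in \<open>C\<close>, and
        the membership of \<open>u\<close> in the ball of competitors.\<close>
      show "0 < Min {q, r, \<epsilon> / (2 * C), t - norm (y - xb)}"
        using q r e C yin by (simp add: dist_norm norm_minus_commute)
      fix u assume "dist u y < Min {q, r, \<epsilon> / (2 * C), t - norm (y - xb)}"
      then have u: "norm (u - y) < q" "norm (u - y) < r" "norm (u - y) < \<epsilon> / (2 * C)"
          "norm (u - y) < t - norm (y - xb)"
        by (auto simp: dist_norm)
      have "norm (u - xb) \<le> norm (u - y) + norm (y - xb)"
        using norm_triangle_ineq[of "u - y" "y - xb"] by simp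
      then have "u \<in> cball xb t" using u(4) by (simp add: dist_norm norm_minus_commute)
      from Ymin[OF this, of m] have "f y + c * (norm (y - xb))\<^sup>2 + m / 2 * (norm (F y - z))\<^sup>2
          \<le> f u + c * (norm (u - xb))\<^sup>2 + m / 2 * (G u)\<^sup>2"
        unfolding y_def[symmetric] h_def Gz dist_norm .
      \<comment> \<open>Keeping \<open>z\<close> fixed for the competitor \<open>u\<close> can only
        increase the penalty and leaves a square that can be expanded around
        \<open>F y\<close>.\<close>
      moreover have "m / 2 * (G u)\<^sup>2 \<le> m / 2 * (norm (F u - z))\<^sup>2"
        using infdist_le[OF z, of "F u"] infdist_nonneg m unfolding G_def dist_norm
        by (intro mult_left_mono power_mono) auto
      moreover have "m / 2 * (norm (F u - z))\<^sup>2 =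
          m / 2 * (norm (F y - z))\<^sup>2 + \<mu> \<bullet> (F u - F y) + m / 2 * (norm (F u - F y))\<^sup>2"
        unfolding \<mu>_def power2_norm_eq_inner by (simp add: algebra_simps inner_commute)
      moreover have "c * (norm (u - xb))\<^sup>2 =
          c * (norm (y - xb))\<^sup>2 + ((2 * c) *\<^sub>R (y - xb)) \<bullet> (u - y) + c * (norm (u - y))\<^sup>2"
        unfolding power2_norm_eq_inner by (simp add: algebra_simps inner_commute)
      moreover have "m / 2 * (norm (F u - F y))\<^sup>2 \<le> m / 2 * (L\<^sup>2 * (norm (u - y))\<^sup>2)"
        using lip[of u y] u(2) r m unfolding power_mult_distrib[symmetric]
        by (intro mult_left_mono power_mono) (auto simp: dist_norm norm_minus_commute)
      moreover have "c * (norm (u - y))\<^sup>2 + m / 2 * (L\<^sup>2 * (norm (u - y))\<^sup>2) \<le> \<epsilon> / 2 * norm (u - y)"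
      proof -
        have "C * norm (u - y) \<le> \<epsilon> / 2" using u(3) C by (simp add: field_simps)
        then have "C * norm (u - y) * norm (u - y) \<le> \<epsilon> / 2 * norm (u - y)"
          by (intro mult_right_mono) auto
        then show ?thesis by (simp add: C_def power2_eq_square algebra_simps)
      qed
      moreover have "f u \<le> f y + grad f y \<bullet> (u - y) + \<epsilon> / 2 * norm (u - y)"
        using fq[OF u(1)] unfolding inner_commute[of _ "grad f y"] real_norm_def abs_le_iff by linarith
      ultimately show "\<mu> \<bullet> F y + (- grad f y - (2 * c) *\<^sub>R (y - xb)) \<bullet> (u - y) - \<epsilon> * norm (u - y) \<le> \<mu> \<bullet> F u"
        unfolding inner_diff_left[of "- grad f y"] inner_diff_right[of \<mu>] inner_minus_left[of "grad f y"]
        by linarith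
    qed
  qed
  moreover have "f y + m / 2 * (norm (F y - z))\<^sup>2 \<le> f xb" using main cn by linarith
  ultimately show thesis
    using that[of m z y] m z near C2 normal unfolding \<mu>_def c_def by simp
qed

text \<open>Frechet differentiability bounds the error by a small multiple of
  \<open>ts k * norm (ws k)\<close>, and convergent directions are bounded, so the directions may
  vary.\<close>

lemma GDERIV_quotient_tendsto:
  fixes f :: "'a::euclidean_space \<Rightarrow> real"
  assumes f: "GDERIV f x :> D"
    and w: "ws \<longlonglongrightarrow> w" and t0: "\<And>k::nat. 0 < ts k" and t: "ts \<longlonglongrightarrow> (0::real)"
  shows "(\<lambda>k. (f (x + ts k *\<^sub>R ws k) - f x) / ts k) \<longlonglongrightarrow> w \<bullet> D"
proof -
  have deriv: "(f has_derivative (\<lambda>h. h \<bullet> D)) (at x)" using f unfolding gderiv_def .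
  have tw: "(\<lambda>k. ts k *\<^sub>R ws k) \<longlonglongrightarrow> 0" using tendsto_scaleR[OF t w] by simp
  obtain B where B: "0 < B" "\<And>k. norm (ws k) \<le> B"
    using convergent_imp_Bseq[OF convergentI[OF w]] unfolding Bseq_def by blast
  have "(\<lambda>k. (f (x + ts k *\<^sub>R ws k) - f x) / ts k - ws k \<bullet> D) \<longlonglongrightarrow> 0"
    unfolding tendsto_iff
  proof (intro allI impI)
    fix e :: real assume e: "0 < e"
    have "0 < e / (2 * B)" using e B by simp
    then obtain q where q: "0 < q" and
      fq: "\<And>u. norm (u - x) < q \<Longrightarrow> norm (f u - f x - (u - x) \<bullet> D) \<le> e / (2 * B) * norm (u - x)"
      using deriv unfolding has_derivative_at_alt by metis
    have "\<forall>\<^sub>F k in sequentially. norm (ts k *\<^sub>R ws k) < q"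
      using tendstoD[OF tw q] by (simp add: dist_norm)
    then show "\<forall>\<^sub>F k in sequentially. dist ((f (x + ts k *\<^sub>R ws k) - f x) / ts k - ws k \<bullet> D) 0 < e"
    proof eventually_elim
      case (elim k)
      have "\<bar>f (x + ts k *\<^sub>R ws k) - f x - ts k * (ws k \<bullet> D)\<bar> \<le> e / (2 * B) * (ts k * norm (ws k))"
        using fq[of "x + ts k *\<^sub>R ws k"] elim t0[of k] by simp
      also have "\<dots> \<le> e / (2 * B) * (ts k * B)"
        using e B t0[of k] by (intro mult_left_mono) auto
      also have "\<dots> = ts k * (e / 2)" using B by simp
      finally have "\<bar>ts k * ((f (x + ts k *\<^sub>R ws k) - f x) / ts k - ws k \<bullet> D)\<bar> \<le> ts k * (e / 2)"
        using t0[of k] by (simp only: right_diff_distrib) simp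
      then have "\<bar>(f (x + ts k *\<^sub>R ws k) - f x) / ts k - ws k \<bullet> D\<bar> \<le> e / 2"
        using t0[of k] by (simp add: abs_mult)
      then show ?case using e by simp
    qed
  qed
  from tendsto_add[OF this tendsto_inner[OF w tendsto_const[of D]]] show ?thesis by simp
qed

text \<open>If the norms do not tend to infinity, infinitely many terms lie in one ball and
  compactness yields a limit. The other alternative concerns the whole sequence, so no reindexing
  happens there.\<close>

lemma subsequence_convergent_or_unbounded:
  fixes l :: "nat \<Rightarrow> 'a::euclidean_space"
  obtains (bounded) r \<mu> where "strict_mono (r :: nat \<Rightarrow> nat)" "(l \<circ> r) \<longlonglongrightarrow> \<mu>"
    | (unbounded) "filterlim (\<lambda>k. norm (l k)) at_top sequentially"
proof (cases "filterlim (\<lambda>k. norm (l k)) at_top sequentially")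
  case False
  then obtain B where "\<not> (\<forall>\<^sub>F k in sequentially. B \<le> norm (l k))"
    unfolding filterlim_at_top by blast
  then have "infinite {k. norm (l k) < B}"
    unfolding infinite_nat_iff_unbounded_le eventually_sequentially by (auto simp: not_le)
  then obtain r :: "nat \<Rightarrow> nat" where r: "strict_mono r" and B: "\<And>k. norm (l (r k)) < B"
    using infinite_enumerate by blast
  then have "\<forall>k. (l \<circ> r) k \<in> cball 0 B" by (simp add: less_imp_le)
  then obtain \<mu> r' where r': "strict_mono r'" and "((l \<circ> r) \<circ> r') \<longlonglongrightarrow> \<mu>"
    using seq_compactE[OF compact_imp_seq_compact[OF compact_cball]] by metis
  then show thesis
    using bounded[OF strict_mono_o[OF r r']] by (simp add: comp_assoc)
qed (rule unbounded)

text \<open>Serves two ways of penalizing: constant \<open>ds\<close> equal to 0 keeps every center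
  at \<open>x\<close>, while a tangent sequence moves the centers along \<open>d\<close>. The
  estimates returned in the unbounded case are the source of (R3): the one on values in the first
  use, the one on the penalty relative to \<open>ts\<close> in the second.\<close>

lemma approximate_stationarity:
  fixes F :: "'a::euclidean_space \<Rightarrow> 'b::euclidean_space"
  assumes cd: "continuously_differentiable f" and dd: "directionally_differentiable F"
    and ll: "locally_lipschitz F" and cl: "closed \<Gamma>" and lm: "local_minimizer f (F -` \<Gamma>) x"
    and d: "ds \<longlonglongrightarrow> d" and t0: "\<And>k::nat. 0 < ts k" and t: "ts \<longlonglongrightarrow> (0::real)"
    and feas: "\<And>k. x + ts k *\<^sub>R ds k \<in> F -` \<Gamma>" and crit: "d \<bullet> grad f x \<le> 0"
  obtains (multiplier) \<mu> where "- grad f x \<in> dir_subdiff (scalarization \<mu> F) x d"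
      "\<mu> \<in> dir_normal_cone \<Gamma> (F x) (dir_deriv F x d)"
    | (unbounded) K ms ws \<delta>s \<xi>s where "\<And>k. 0 < ms k" "ws \<longlonglongrightarrow> d"
      "(\<lambda>k. ms k * (norm (\<delta>s k))\<^sup>2 / ts (k + K)) \<longlonglongrightarrow> 0"
      "\<And>k. f (x + ts (k + K) *\<^sub>R ws k) + ms k / 2 * (norm (\<delta>s k))\<^sup>2 \<le> f (x + ts (k + K) *\<^sub>R ds (k + K))"
      "R1 F \<Gamma> (\<lambda>k. x + ts (k + K) *\<^sub>R ws k) (\<lambda>k. ms k *\<^sub>R \<delta>s k) \<delta>s \<xi>s"
      "R2 x (- grad f x) (\<lambda>k. x + ts (k + K) *\<^sub>R ws k) (\<lambda>k. ms k *\<^sub>R \<delta>s k) \<delta>s \<xi>s"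
proof -
  have fd: "f differentiable at u" for u
    using cd by (simp add: continuously_differentiable_def)
  have contg: "continuous_on UNIV (grad f)"
    using cd by (simp add: continuously_differentiable_def)
  obtain R where R: "0 < R" and Rmin: "\<And>u. u \<in> F -` \<Gamma> \<Longrightarrow> u \<in> ball x R \<Longrightarrow> f x \<le> f u"
    and xX: "x \<in> F -` \<Gamma>"
    using lm unfolding local_minimizer_def by blast
  \<comment> \<open>The excess of \<open>f\<close> at the center per unit of step length;
    criticality of \<open>d\<close> forces it to 0. In \<open>s\<close>, the fourth root fits the
    excess \<open>s ^ 4 * t\<close> allowed by the penalization, and the added \<open>ts k\<close>
    keeps \<open>s k\<close> positive.\<close>
  define q where "q k = max 0 ((f (x + ts k *\<^sub>R ds k) - f x) / ts k)" for k
  define s where "s k = sqrt (sqrt (q k + ts k))" for k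
  have q0: "0 \<le> q k" for k by (simp add: q_def)
  have s0: "0 < s k" for k using q0[of k] t0[of k] by (simp add: s_def add_nonneg_pos)
  have s4: "s k ^ 4 = q k + ts k" for k
  proof -
    have "s k ^ 4 = ((s k)\<^sup>2)\<^sup>2" by simp
    also have "\<dots> = q k + ts k"
      using q0[of k] t0[of k] unfolding s_def by (simp add: add_nonneg_nonneg less_imp_le)
    finally show ?thesis .
  qed
  have "q \<longlonglongrightarrow> max 0 (d \<bullet> grad f x)"
    unfolding q_def
    by (intro tendsto_max tendsto_const GDERIV_quotient_tendsto[OF GDERIV_grad[OF fd] d t0 t])
  then have "(\<lambda>k. sqrt (sqrt (q k + ts k))) \<longlonglongrightarrow> sqrt (sqrt (max 0 (d \<bullet> grad f x) + 0))"
    by (intro tendsto_intros t)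
  then have s: "s \<longlonglongrightarrow> 0" using crit unfolding s_def by (simp add: max_absorb1)
  have "\<forall>\<^sub>F k in sequentially. s k < 1 / 2"
    using s by (rule order_tendstoD) simp
  \<comment> \<open>The extra \<open>ts k\<close> is the radius of the ball searched around the
    center: all of it must lie where \<open>x\<close> is minimal among feasible points.\<close>
  moreover have "\<forall>\<^sub>F k in sequentially. norm (ts k *\<^sub>R ds k) + ts k < R"
  proof (rule order_tendstoD)
    show "(\<lambda>k. norm (ts k *\<^sub>R ds k) + ts k) \<longlonglongrightarrow> norm (0 *\<^sub>R d) + 0"
      by (intro tendsto_intros t d)
  qed (use R in simp)
  ultimately have "\<forall>\<^sub>F k in sequentially. s k < 1 / 2 \<and> norm (ts k *\<^sub>R ds k) + ts k < R"
    by eventually_elim simp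
  then obtain K where K: "\<And>k. k \<ge> K \<Longrightarrow> s k < 1 / 2 \<and> norm (ts k *\<^sub>R ds k) + ts k < R"
    unfolding eventually_sequentially by blast
  define xb where "xb k = x + ts k *\<^sub>R ds k" for k
  \<comment> \<open>The bound \<open>1 / ts k < m\<close> is what later turns the estimate of the
    penalty relative to \<open>ts k\<close> into smallness of \<open>F y - z\<close> relative to
    \<open>ts k\<close>.\<close>
  have "\<exists>y z m. 1 / ts k < m \<and> 0 < m \<and> z \<in> \<Gamma> \<and> norm (y - xb k) \<le> 2 * s k * ts k \<and>
    f y + m / 2 * (norm (F y - z))\<^sup>2 \<le> f (xb k) \<and> m * (norm (F y - z))\<^sup>2 \<le> 4 * s k ^ 4 * ts k \<and>
    m *\<^sub>R (F y - z) \<in> regular_normal_cone \<Gamma> z \<and>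
    frechet_subgradient (scalarization (m *\<^sub>R (F y - z)) F) y
      (- grad f y - (2 * (s k)\<^sup>2 / ts k) *\<^sub>R (y - xb k))" if k: "k \<ge> K" for k
  proof -
    have xbX: "xb k \<in> F -` \<Gamma>" using feas by (simp add: xb_def)
    have low: "f x \<le> f u" if "u \<in> F -` \<Gamma>" "u \<in> cball (xb k) (ts k)" for u
    proof (rule Rmin[OF that(1)])
      have "norm (u - x) \<le> norm (u - xb k) + norm (ts k *\<^sub>R ds k)"
        using norm_triangle_ineq[of "u - xb k" "ts k *\<^sub>R ds k"] by (simp add: xb_def)
      then show "u \<in> ball x R"
        using that(2) K[OF k] by (simp add: dist_norm norm_minus_commute)
    qed
    have "f (xb k) - f x \<le> q k * ts k"
      using t0[of k] unfolding q_def xb_def by (simp add: max_def field_simps)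
    then have up: "f (xb k) \<le> f x + s k ^ 4 * ts k"
      using zero_le_square[of "ts k"] unfolding s4 distrib_right by linarith
    have "2 * s k < 1" using K[OF k] by simp
    then show ?thesis
      using penalized_minimizer[OF fd ll cl xbX low up s0 _ t0] by metis
  qed
  \<comment> \<open>Shifting by \<open>K\<close> removes the guard on the index, so that the chosen
    sequences have these properties at every index, as (R1) demands.\<close>
  then have "\<exists>y z m. 1 / ts (k + K) < m \<and> 0 < m \<and> z \<in> \<Gamma> \<and>
    norm (y - xb (k + K)) \<le> 2 * s (k + K) * ts (k + K) \<and>
    f y + m / 2 * (norm (F y - z))\<^sup>2 \<le> f (xb (k + K)) \<and>
    m * (norm (F y - z))\<^sup>2 \<le> 4 * s (k + K) ^ 4 * ts (k + K) \<and>
    m *\<^sub>R (F y - z) \<in> regular_normal_cone \<Gamma> z \<and>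
    frechet_subgradient (scalarization (m *\<^sub>R (F y - z)) F) y
      (- grad f y - (2 * (s (k + K))\<^sup>2 / ts (k + K)) *\<^sub>R (y - xb (k + K)))" for k
    by simp
  then obtain ys zs ms where m1: "\<And>k. 1 / ts (k + K) < ms k" and m0: "\<And>k. 0 < ms k"
    and near: "\<And>k. norm (ys k - xb (k + K)) \<le> 2 * s (k + K) * ts (k + K)"
    and val: "\<And>k. f (ys k) + ms k / 2 * (norm (F (ys k) - zs k))\<^sup>2 \<le> f (xb (k + K))"
    and pen: "\<And>k. ms k * (norm (F (ys k) - zs k))\<^sup>2 \<le> 4 * s (k + K) ^ 4 * ts (k + K)"
    and nrm: "\<And>k. ms k *\<^sub>R (F (ys k) - zs k) \<in> regular_normal_cone \<Gamma> (zs k)"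
    and sub: "\<And>k. frechet_subgradient (scalarization (ms k *\<^sub>R (F (ys k) - zs k)) F) (ys k)
      (- grad f (ys k) - (2 * (s (k + K))\<^sup>2 / ts (k + K)) *\<^sub>R (ys k - xb (k + K)))"
    by metis
  define \<tau> where "\<tau> k = ts (k + K)" for k
  define \<sigma> where "\<sigma> k = s (k + K)" for k
  define \<delta>s where "\<delta>s k = F (ys k) - zs k" for k
  define ls where "ls k = ms k *\<^sub>R \<delta>s k" for k
  define \<xi>s where "\<xi>s k = - grad f (ys k) - (2 * (\<sigma> k)\<^sup>2 / \<tau> k) *\<^sub>R (ys k - xb (k + K))" for k
  define ws where "ws k = (ys k - x) /\<^sub>R \<tau> k" for k
  have \<tau>0: "0 < \<tau> k" and \<sigma>0: "0 < \<sigma> k" for k using t0 s0 by (auto simp: \<tau>_def \<sigma>_def)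
  have \<tau>: "\<tau> \<longlonglongrightarrow> 0" and \<sigma>: "\<sigma> \<longlonglongrightarrow> 0"
    unfolding \<tau>_def \<sigma>_def using LIMSEQ_ignore_initial_segment[OF t] LIMSEQ_ignore_initial_segment[OF s]
    by auto
  have ysw: "x + \<tau> k *\<^sub>R ws k = ys k" for k using \<tau>0[of k] by (simp add: ws_def)
  have "(\<lambda>k. ws k - ds (k + K)) \<longlonglongrightarrow> 0"
  proof (rule Lim_null_comparison[OF always_eventually])
    show "(\<lambda>k. 2 * \<sigma> k) \<longlonglongrightarrow> 0" using tendsto_mult_right_zero[OF \<sigma>] .
    show "\<forall>k. norm (ws k - ds (k + K)) \<le> 2 * \<sigma> k"
    proof
      fix k
      have "\<tau> k *\<^sub>R (ws k - ds (k + K)) = ys k - xb (k + K)"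
        using ysw[of k] by (simp add: xb_def algebra_simps \<tau>_def)
      then have "\<tau> k * norm (ws k - ds (k + K)) = norm (ys k - xb (k + K))"
        using \<tau>0[of k] by (metis norm_scaleR abs_of_pos)
      then have "\<tau> k * norm (ws k - ds (k + K)) \<le> \<tau> k * (2 * \<sigma> k)"
        using near[of k] by (simp add: \<tau>_def \<sigma>_def mult_ac)
      then show "norm (ws k - ds (k + K)) \<le> 2 * \<sigma> k" using \<tau>0[of k] by simp
    qed
  qed
  from tendsto_add[OF this LIMSEQ_ignore_initial_segment[OF d, of K]]
  have ws: "ws \<longlonglongrightarrow> d" by simp
  have pend: "(\<lambda>k. ms k * (norm (\<delta>s k))\<^sup>2 / \<tau> k) \<longlonglongrightarrow> 0"
  proof (rule Lim_null_comparison[OF always_eventually])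
    show "(\<lambda>k. 4 * \<sigma> k ^ 4) \<longlonglongrightarrow> 0"
      using tendsto_mult[OF tendsto_const tendsto_power[OF \<sigma>], of 4 4] by simp
    show "\<forall>k. norm (ms k * (norm (\<delta>s k))\<^sup>2 / \<tau> k) \<le> 4 * \<sigma> k ^ 4"
      using pen m0 \<tau>0 by (simp add: pos_divide_le_eq \<delta>s_def \<tau>_def \<sigma>_def less_imp_le)
  qed
  have \<delta>\<tau>: "(\<lambda>k. \<delta>s k /\<^sub>R \<tau> k) \<longlonglongrightarrow> 0"
  proof (rule Lim_null_comparison[OF always_eventually])
    show "(\<lambda>k. sqrt (ms k * (norm (\<delta>s k))\<^sup>2 / \<tau> k)) \<longlonglongrightarrow> 0"
      using tendsto_real_sqrt[OF pend] by simp
    show "\<forall>k. norm (\<delta>s k /\<^sub>R \<tau> k) \<le> sqrt (ms k * (norm (\<delta>s k))\<^sup>2 / \<tau> k)"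
    proof
      fix k
      have "(norm (\<delta>s k /\<^sub>R \<tau> k))\<^sup>2 = (1 / \<tau> k) * (norm (\<delta>s k))\<^sup>2 / \<tau> k"
        using \<tau>0[of k] by (simp add: power_mult_distrib power2_eq_square divide_simps)
      also have "\<dots> \<le> ms k * (norm (\<delta>s k))\<^sup>2 / \<tau> k"
        using m1[of k] \<tau>0[of k] unfolding \<tau>_def by (intro divide_right_mono mult_right_mono) auto
      finally show "norm (\<delta>s k /\<^sub>R \<tau> k) \<le> sqrt (ms k * (norm (\<delta>s k))\<^sup>2 / \<tau> k)"
        by (rule real_le_rsqrt)
    qed
  qed
  have "(\<lambda>k. x + \<tau> k *\<^sub>R ws k) \<longlonglongrightarrow> x + 0 *\<^sub>R d" by (intro tendsto_intros \<tau> ws)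
  then have ys: "ys \<longlonglongrightarrow> x" by (simp add: ysw)
  have "(\<lambda>k. \<tau> k *\<^sub>R (\<delta>s k /\<^sub>R \<tau> k)) \<longlonglongrightarrow> 0 *\<^sub>R 0" by (intro tendsto_intros \<tau> \<delta>\<tau>)
  then have \<delta>: "\<delta>s \<longlonglongrightarrow> 0" using \<tau>0 by (simp add: less_imp_neq[symmetric])
  have "(\<lambda>k. (2 * (\<sigma> k)\<^sup>2 / \<tau> k) *\<^sub>R (ys k - xb (k + K))) \<longlonglongrightarrow> 0"
  proof (rule Lim_null_comparison[OF always_eventually])
    show "(\<lambda>k. 4 * \<sigma> k ^ 3) \<longlonglongrightarrow> 0"
      using tendsto_mult[OF tendsto_const tendsto_power[OF \<sigma>], of 4 3] by simp
    show "\<forall>k. norm ((2 * (\<sigma> k)\<^sup>2 / \<tau> k) *\<^sub>R (ys k - xb (k + K))) \<le> 4 * \<sigma> k ^ 3"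
    proof
      fix k
      have "(2 * (\<sigma> k)\<^sup>2 / \<tau> k) * norm (ys k - xb (k + K)) \<le> (2 * (\<sigma> k)\<^sup>2 / \<tau> k) * (2 * \<sigma> k * \<tau> k)"
        using near[of k] \<tau>0[of k] by (intro mult_left_mono) (auto simp: \<tau>_def \<sigma>_def)
      also have "\<dots> = 4 * \<sigma> k ^ 3" using \<tau>0[of k] by (simp add: power2_eq_square power3_eq_cube)
      finally show "norm ((2 * (\<sigma> k)\<^sup>2 / \<tau> k) *\<^sub>R (ys k - xb (k + K))) \<le> 4 * \<sigma> k ^ 3"
        using \<tau>0[of k] by simp
    qed
  qed
  moreover have "(\<lambda>k. grad f (ys k)) \<longlonglongrightarrow> grad f x"
    using continuous_on_tendsto_compose[OF contg ys] by simp
  ultimately have \<xi>: "\<xi>s \<longlonglongrightarrow> - grad f x"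
    unfolding \<xi>s_def using tendsto_diff[OF tendsto_minus] by fastforce
  have sub': "frechet_subgradient (scalarization (ls k) F) (ys k) (\<xi>s k)" for k
    using sub[of k] by (simp add: ls_def \<delta>s_def \<xi>s_def \<tau>_def \<sigma>_def)
  have nrm': "ls k \<in> regular_normal_cone \<Gamma> (F (ys k) - \<delta>s k)" for k
    using nrm[of k] by (simp add: ls_def \<delta>s_def)
  show thesis
  proof (rule subsequence_convergent_or_unbounded[of ls])
    fix r :: "nat \<Rightarrow> nat" and \<mu> assume r: "strict_mono r" and \<mu>: "(ls \<circ> r) \<longlonglongrightarrow> \<mu>"
    note lim = LIMSEQ_subseq_LIMSEQ[OF _ r, unfolded o_def]
    have \<mu>': "(\<lambda>k. ls (r k)) \<longlonglongrightarrow> \<mu>" using \<mu> by (simp add: o_def)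
    have "- grad f x \<in> dir_subdiff (scalarization \<mu> F) x d"
      using multiplier_limit_dir_subdiff[OF dd ll lim[OF ws] _ lim[OF \<tau>] \<mu>' lim[OF \<xi>]] \<tau>0 sub'
      by (simp add: ysw)
    moreover have "\<mu> \<in> dir_normal_cone \<Gamma> (F x) (dir_deriv F x d)"
      unfolding dir_normal_cone_def mem_Collect_eq
    proof (intro conjI exI)
      \<comment> \<open>Chosen so that \<open>\<tau> k *\<^sub>R us k\<close> leads from
        \<open>F x\<close> exactly to the point \<open>F (ys k) - \<delta>s k\<close> of
        \<open>\<Gamma>\<close>. As \<open>\<delta>s k\<close> is of smaller order than
        \<open>\<tau> k\<close>, only the directional derivative remains in the limit.\<close>
      define us where "us k = (F (x + \<tau> k *\<^sub>R ws k) - F x) /\<^sub>R \<tau> k - \<delta>s k /\<^sub>R \<tau> k" for k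
      have "us \<longlonglongrightarrow> dir_deriv F x d - 0"
        unfolding us_def by (intro tendsto_diff difference_quotient_tendsto[OF dd ll ws \<tau>0 \<tau>] \<delta>\<tau>)
      then show "(\<lambda>k. us (r k)) \<longlonglongrightarrow> dir_deriv F x d" using lim by simp
      have "F x + \<tau> k *\<^sub>R us k = F (ys k) - \<delta>s k" for k
        using \<tau>0[of k] unfolding us_def ysw by (simp add: scaleR_right_diff_distrib)
      then show "\<forall>k. ls (r k) \<in> regular_normal_cone \<Gamma> (F x + \<tau> (r k) *\<^sub>R us (r k))"
        using nrm' by simp
      show "(\<lambda>k. \<tau> (r k)) \<longlonglongrightarrow> 0" using lim[OF \<tau>] .
      show "(\<lambda>k. ls (r k)) \<longlonglongrightarrow> \<mu>" by (rule \<mu>')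
    qed (use xX \<tau>0 in auto)
    ultimately show thesis by (rule multiplier)
  next
    assume inf: "filterlim (\<lambda>k. norm (ls k)) at_top sequentially"
    show thesis
    proof (rule unbounded[of ms ws \<delta>s K \<xi>s])
      show "R1 F \<Gamma> (\<lambda>k. x + ts (k + K) *\<^sub>R ws k) (\<lambda>k. ms k *\<^sub>R \<delta>s k) \<delta>s \<xi>s"
        using frechet_subgradient_subdiff[OF sub'] regular_normal_imp_normal[OF nrm']
        unfolding R1_def \<tau>_def[symmetric] ysw ls_def by blast
      show "R2 x (- grad f x) (\<lambda>k. x + ts (k + K) *\<^sub>R ws k) (\<lambda>k. ms k *\<^sub>R \<delta>s k) \<delta>s \<xi>s"
        using ys \<delta> \<xi> inf unfolding R2_def \<tau>_def[symmetric] ysw ls_def by blast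
      show "f (x + ts (k + K) *\<^sub>R ws k) + ms k / 2 * (norm (\<delta>s k))\<^sup>2 \<le> f (x + ts (k + K) *\<^sub>R ds (k + K))" for k
        using val[of k] unfolding \<tau>_def[symmetric] ysw \<delta>s_def by (simp add: xb_def \<tau>_def)
    qed (use m0 ws pend in \<open>simp_all add: \<tau>_def\<close>)
  qed
qed

section \<open>Asymptotic regularity as a constraint qualification\<close>

lemma R1_subseq: "R1 F \<Gamma> xs ls \<delta>s \<xi>s \<Longrightarrow>
    R1 F \<Gamma> (\<lambda>k. xs (r k)) (\<lambda>k. ls (r k)) (\<lambda>k. \<delta>s (r k)) (\<lambda>k. \<xi>s (r k))"
  by (simp add: R1_def)

lemma R2_subseq:
  assumes "R2 x \<xi> xs ls \<delta>s \<xi>s" and r: "strict_mono r"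
  shows "R2 x \<xi> (\<lambda>k. xs (r k)) (\<lambda>k. ls (r k)) (\<lambda>k. \<delta>s (r k)) (\<lambda>k. \<xi>s (r k))"
  using assms(1) filterlim_subseq[OF r] unfolding R2_def
  by (auto intro: filterlim_compose[where g = xs] filterlim_compose[where g = \<delta>s]
      filterlim_compose[where g = \<xi>s] filterlim_compose[where g = "\<lambda>k. norm (ls k)"])

text \<open>The multiplier is a positive multiple of \<open>\<delta>s k\<close>, so the difference
  in the little-o condition is exactly zero and the product of the norms is
  \<open>ms k * (norm (\<delta>s k))\<^sup>2\<close>. Thus \<open>bdd\<close> is the last condition
  of (R3), and division by the diverging multiplier norms gives the relative smallness of
  \<open>\<delta>s k\<close>.\<close>

lemma R3_scaled_multiplier:
  fixes \<delta>s :: "nat \<Rightarrow> 'b::euclidean_space"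
  assumes m0: "\<And>k. 0 < ms k" and ne: "\<And>k. xs k \<noteq> x"
    and dir: "(\<lambda>k. (xs k - x) /\<^sub>R norm (xs k - x)) \<longlonglongrightarrow> d"
    and bdd: "Bseq (\<lambda>k. ms k * (norm (\<delta>s k))\<^sup>2 / norm (xs k - x))"
    and inf: "filterlim (\<lambda>k. norm (ms k *\<^sub>R \<delta>s k)) at_top sequentially"
  shows "R3 x d xs (\<lambda>k. ms k *\<^sub>R \<delta>s k) \<delta>s"
proof -
  have "Zfun (\<lambda>k. inverse (norm (ms k *\<^sub>R \<delta>s k))) sequentially"
    using tendsto_inverse_0_at_top[OF inf] by (simp add: tendsto_Zfun_iff)
  from bounded_bilinear.Bfun_prod_Zfun[OF bounded_bilinear_mult bdd this]
  have "(\<lambda>k. (ms k * (norm (\<delta>s k))\<^sup>2 / norm (xs k - x)) * inverse (norm (ms k *\<^sub>R \<delta>s k))) \<longlonglongrightarrow> 0"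
    by (simp add: tendsto_Zfun_iff)
  moreover have "(ms k * (norm (\<delta>s k))\<^sup>2 / norm (xs k - x)) * inverse (norm (ms k *\<^sub>R \<delta>s k)) =
      norm (\<delta>s k /\<^sub>R norm (xs k - x))" for k
    using m0[of k] ne[of k] by (cases "\<delta>s k = 0") (simp_all add: power2_eq_square divide_simps)
  ultimately have "(\<lambda>k. norm (\<delta>s k /\<^sub>R norm (xs k - x))) \<longlonglongrightarrow> 0" by simp
  then have small: "(\<lambda>k. \<delta>s k /\<^sub>R norm (xs k - x)) \<longlonglongrightarrow> 0" by (rule tendsto_norm_zero_cancel)
  have par: "norm (\<delta>s k) *\<^sub>R ms k *\<^sub>R \<delta>s k - norm (ms k *\<^sub>R \<delta>s k) *\<^sub>R \<delta>s k = 0" for k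
    using m0[of k] by (simp add: mult.commute)
  have "norm (\<delta>s k) * norm (ms k *\<^sub>R \<delta>s k) = ms k * (norm (\<delta>s k))\<^sup>2" for k
    using m0[of k] by (simp add: power2_eq_square)
  then have "bounded (range (\<lambda>k. norm (\<delta>s k) * norm (ms k *\<^sub>R \<delta>s k) / norm (xs k - x)))"
    using bdd by (simp only: Bseq_eq_bounded)
  moreover have "small_o (\<lambda>k. norm (\<delta>s k) *\<^sub>R ms k *\<^sub>R \<delta>s k - norm (ms k *\<^sub>R \<delta>s k) *\<^sub>R \<delta>s k)
      (\<lambda>k. norm (\<delta>s k) * norm (ms k *\<^sub>R \<delta>s k))"
    unfolding small_o_def par by (intro exI[of _ "\<lambda>_. 0"]) simp
  ultimately show ?thesis
    unfolding R3_def using ne dir small by blast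
qed

section \<open>Stationarity from multipliers and regularity\<close>

lemma frechet_derivative_grad:
  assumes "continuously_differentiable f"
  shows "frechet_derivative f (at x) d = d \<bullet> grad f x"
proof -
  have "(f has_derivative (\<lambda>h. h \<bullet> grad f x)) (at x)"
    using GDERIV_grad[of f x] assms unfolding gderiv_def continuously_differentiable_def by blast
  then show ?thesis
    by (simp flip: frechet_derivative_at)
qed

lemma M_stationaryI_dir:
  assumes "x \<in> F -` \<Gamma>" "- grad f x \<in> dir_subdiff (scalarization \<mu> F) x d"
    "\<mu> \<in> dir_normal_cone \<Gamma> (F x) w"
  shows "M_stationary f F \<Gamma> x"
  using assms dir_subdiff_subset_subdiff dir_normal_subset_normal unfolding M_stationary_def by blast

text \<open>Penalization takes place around \<open>x\<close> itself, with direction 0 and an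
  arbitrary null sequence of step lengths. A convergent subsequence of multipliers gives a
  multiplier in direction 0; unbounded multipliers are covered by regularity.\<close>

lemma AM_regular_imp_M_stationary:
  fixes F :: "'a::euclidean_space \<Rightarrow> 'b::euclidean_space"
  assumes cd: "continuously_differentiable f" and dd: "directionally_differentiable F"
    and ll: "locally_lipschitz F" and cl: "closed \<Gamma>" and lm: "local_minimizer f (F -` \<Gamma>) x"
    and reg: "AM_regular F \<Gamma> x"
  shows "M_stationary f F \<Gamma> x"
proof -
  have xX: "x \<in> F -` \<Gamma>" using lm by (simp add: local_minimizer_def)
  have feas: "x + inverse (real (Suc k)) *\<^sub>R 0 \<in> F -` \<Gamma>" for k using xX by simp
  show ?thesis
  proof (rule approximate_stationarity[OF cd dd ll cl lm, 
        where ds = "\<lambda>_. 0", OF tendsto_const _ LIMSEQ_inverse_real_of_nat feas])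
    fix \<mu> assume "- grad f x \<in> dir_subdiff (scalarization \<mu> F) x 0"
      and "\<mu> \<in> dir_normal_cone \<Gamma> (F x) (dir_deriv F x 0)"
    then show ?thesis by (rule M_stationaryI_dir[OF xX])
  next
    fix xs ls \<delta>s \<xi>s
    assume "R1 F \<Gamma> xs ls \<delta>s \<xi>s" "R2 x (- grad f x) xs ls \<delta>s \<xi>s"
    then show ?thesis
      using reg xX unfolding AM_regular_def M_stationary_def by blast
  qed simp_all
qed

text \<open>Since \<open>d\<close> is a unit vector, the distance of the iterates to
  \<open>x\<close> is comparable with the step length. Estimates relative to \<open>ts\<close>
  therefore become estimates relative to that distance, which is what (R3) asks for.\<close>

lemma directional_multiplier_or_R123:
  fixes F :: "'a::euclidean_space \<Rightarrow> 'b::euclidean_space"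
  assumes cd: "continuously_differentiable f" and dd: "directionally_differentiable F"
    and ll: "locally_lipschitz F" and cl: "closed \<Gamma>" and lm: "local_minimizer f (F -` \<Gamma>) x"
    and dC: "d \<in> implicit_critical_cone f F \<Gamma> x" and d1: "norm d = 1"
  obtains (multiplier) \<mu> where "- grad f x \<in> dir_subdiff (scalarization \<mu> F) x d"
      "\<mu> \<in> dir_normal_cone \<Gamma> (F x) (dir_deriv F x d)"
    | (unbounded) xs ls \<delta>s \<xi>s where "R1 F \<Gamma> xs ls \<delta>s \<xi>s" "R2 x (- grad f x) xs ls \<delta>s \<xi>s"
      "R3 x d xs ls \<delta>s"
proof -
  have crit: "d \<bullet> grad f x \<le> 0" and "d \<in> tangent_cone (F -` \<Gamma>) x"
    using dC by (simp_all add: implicit_critical_cone_def frechet_derivative_grad[OF cd])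
  then obtain ds ts where d: "ds \<longlonglongrightarrow> d" and t0: "\<And>k. 0 < ts k" and t: "ts \<longlonglongrightarrow> (0::real)"
    and feas: "\<And>k::nat. x + ts k *\<^sub>R ds k \<in> F -` \<Gamma>"
    unfolding tangent_cone_def by blast
  show thesis
  proof (rule approximate_stationarity[OF cd dd ll cl lm d t0 t feas crit])
    show thesis if "- grad f x \<in> dir_subdiff (scalarization \<mu> F) x d"
      "\<mu> \<in> dir_normal_cone \<Gamma> (F x) (dir_deriv F x d)" for \<mu>
      using multiplier that .
  next
    fix K ms ws \<delta>s \<xi>s
    assume m0: "\<And>k. 0 < ms k" and ws: "ws \<longlonglongrightarrow> d"
      and pen: "(\<lambda>k. ms k * (norm (\<delta>s k))\<^sup>2 / ts (k + K)) \<longlonglongrightarrow> 0"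
      and r1: "R1 F \<Gamma> (\<lambda>k. x + ts (k + K) *\<^sub>R ws k) (\<lambda>k. ms k *\<^sub>R \<delta>s k) \<delta>s \<xi>s"
      and r2: "R2 x (- grad f x) (\<lambda>k. x + ts (k + K) *\<^sub>R ws k) (\<lambda>k. ms k *\<^sub>R \<delta>s k) \<delta>s \<xi>s"
    have dne: "d \<noteq> 0" using d1 by auto
    have "\<forall>\<^sub>F k in sequentially. ws k \<noteq> 0"
      using tendsto_imp_eventually_ne[OF ws dne] .
    then obtain J where J: "\<And>k. k \<ge> J \<Longrightarrow> ws k \<noteq> 0"
      unfolding eventually_sequentially by blast
    \<comment> \<open>(R3) excludes the point \<open>x\<close> at every index, so the first
      \<open>J\<close> terms are cut off.\<close>
    define r where "r k = k + J" for k
    have r: "strict_mono r" by (simp add: r_def strict_mono_def)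
    define xs where "xs k = x + ts (r k + K) *\<^sub>R ws (r k)" for k
    note lim = LIMSEQ_subseq_LIMSEQ[OF _ r, unfolded o_def]
    have nx: "norm (xs k - x) = ts (r k + K) * norm (ws (r k))" for k
      using t0[of "r k + K"] by (simp add: xs_def)
    have r1': "R1 F \<Gamma> xs (\<lambda>k. ms (r k) *\<^sub>R \<delta>s (r k)) (\<lambda>k. \<delta>s (r k)) (\<lambda>k. \<xi>s (r k))"
      using R1_subseq[OF r1, of r] unfolding xs_def .
    have r2': "R2 x (- grad f x) xs (\<lambda>k. ms (r k) *\<^sub>R \<delta>s (r k)) (\<lambda>k. \<delta>s (r k)) (\<lambda>k. \<xi>s (r k))"
      using R2_subseq[OF r2 r] unfolding xs_def .
    have "R3 x d xs (\<lambda>k. ms (r k) *\<^sub>R \<delta>s (r k)) (\<lambda>k. \<delta>s (r k))"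
    proof (rule R3_scaled_multiplier)
      show "xs k \<noteq> x" for k
        using t0[of "r k + K"] J[of "r k"] by (simp add: xs_def r_def)
      have "(\<lambda>k. sgn (ws (r k))) \<longlonglongrightarrow> sgn d"
        by (intro tendsto_sgn lim ws dne)
      moreover have "(xs k - x) /\<^sub>R norm (xs k - x) = sgn (ws (r k))" for k
        using t0[of "r k + K"] unfolding nx by (simp add: xs_def sgn_div_norm)
      moreover have "sgn d = d" using d1 by (simp add: sgn_div_norm)
      ultimately show "(\<lambda>k. (xs k - x) /\<^sub>R norm (xs k - x)) \<longlonglongrightarrow> d" by simp
      have "(\<lambda>k. (ms (r k) * (norm (\<delta>s (r k)))\<^sup>2 / ts (r k + K)) / norm (ws (r k))) \<longlonglongrightarrow> 0 / norm d"
        by (intro tendsto_divide tendsto_norm lim[OF ws] lim[OF pen]) (use dne in simp)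
      then have "(\<lambda>k. ms (r k) * (norm (\<delta>s (r k)))\<^sup>2 / norm (xs k - x)) \<longlonglongrightarrow> 0"
        unfolding nx by simp
      then show "Bseq (\<lambda>k. ms (r k) * (norm (\<delta>s (r k)))\<^sup>2 / norm (xs k - x))"
        by (intro convergent_imp_Bseq convergentI)
      show "filterlim (\<lambda>k. norm (ms (r k) *\<^sub>R \<delta>s (r k))) at_top sequentially"
        using r2' by (simp add: R2_def)
    qed (rule m0)
    with r1' r2' show thesis by (rule unbounded)
  qed
qed

text \<open>The bounded alternative yields a directional multiplier, which suffices for both
  conclusions. Regularity handles unbounded multipliers, and its strength decides whether the
  direction is kept.\<close>

lemma implicit_critical_imp_stationary:
  fixes F :: "'a::euclidean_space \<Rightarrow> 'b::euclidean_space"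
  assumes cd: "continuously_differentiable f" and dd: "directionally_differentiable F"
    and ll: "locally_lipschitz F" and cl: "closed \<Gamma>" and lm: "local_minimizer f (F -` \<Gamma>) x"
    and dC: "d \<in> implicit_critical_cone f F \<Gamma> x" and d1: "norm d = 1"
  shows "dir_AM_regular F \<Gamma> x d \<Longrightarrow> M_stationary f F \<Gamma> x"
    and "strongly_dir_AM_regular F \<Gamma> x d \<Longrightarrow> dir_M_stationary f F \<Gamma> x d"
proof -
  have xX: "x \<in> F -` \<Gamma>" using lm by (simp add: local_minimizer_def)
  show "M_stationary f F \<Gamma> x" if reg: "dir_AM_regular F \<Gamma> x d"
  proof (rule directional_multiplier_or_R123[OF cd dd ll cl lm dC d1])
    fix \<mu> assume "- grad f x \<in> dir_subdiff (scalarization \<mu> F) x d"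
      and "\<mu> \<in> dir_normal_cone \<Gamma> (F x) (dir_deriv F x d)"
    then show ?thesis by (rule M_stationaryI_dir[OF xX])
  next
    fix xs ls \<delta>s \<xi>s
    assume "R1 F \<Gamma> xs ls \<delta>s \<xi>s" "R2 x (- grad f x) xs ls \<delta>s \<xi>s" "R3 x d xs ls \<delta>s"
    then show ?thesis
      using reg xX unfolding dir_AM_regular_def M_stationary_def by blast
  qed
  show "dir_M_stationary f F \<Gamma> x d" if reg: "strongly_dir_AM_regular F \<Gamma> x d"
  proof -
    \<comment> \<open>Membership in the linearization cone is read off the regularity assumption,
      not derived from tangency.\<close>
    have "d \<in> critical_cone f F \<Gamma> x"
      using dC reg by (simp add: implicit_critical_cone_def critical_cone_def strongly_dir_AM_regular_def)
    moreover have "\<exists>\<mu>. - grad f x \<in> dir_subdiff (scalarization \<mu> F) x d \<and>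
        \<mu> \<in> dir_normal_cone \<Gamma> (F x) (dir_deriv F x d)"
    proof (rule directional_multiplier_or_R123[OF cd dd ll cl lm dC d1])
      fix xs ls \<delta>s \<xi>s
      assume "R1 F \<Gamma> xs ls \<delta>s \<xi>s" "R2 x (- grad f x) xs ls \<delta>s \<xi>s" "R3 x d xs ls \<delta>s"
      then show ?thesis
        using reg unfolding strongly_dir_AM_regular_def by blast
    qed blast
    ultimately show ?thesis using xX by (simp add: dir_M_stationary_def)
  qed
qed

text \<open>The proof of (d) penalizes around \<open>x\<close> itself, so every penalized minimizer \<open>y\<close> satisfies
  \<open>f y + m / 2 * \<parallel>\<delta>\<parallel>\<^sup>2 \<le> f x\<close>. Hence a limit direction of the \<open>y - x\<close> is critical, and \<open>m * \<parallel>\<delta>\<parallel>\<^sup>2\<close> is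
  of order \<open>\<parallel>y - x\<parallel>\<close>.\<close>

lemma all_directions_imp_M_stationary:
  fixes F :: "'a::euclidean_space \<Rightarrow> 'b::euclidean_space"
  assumes cd: "continuously_differentiable f" and dd: "directionally_differentiable F"
    and ll: "locally_lipschitz F" and cl: "closed \<Gamma>" and lm: "local_minimizer f (F -` \<Gamma>) x"
    and reg: "\<And>d. d \<in> critical_cone f F \<Gamma> x \<Longrightarrow> norm d = 1 \<Longrightarrow> dir_AM_regular F \<Gamma> x d"
  shows "M_stationary f F \<Gamma> x"
proof -
  have xX: "x \<in> F -` \<Gamma>" using lm by (simp add: local_minimizer_def)
  have feas: "x + inverse (real (Suc k)) *\<^sub>R 0 \<in> F -` \<Gamma>" for k using xX by simp
  show ?thesis
  proof (rule approximate_stationarity[OF cd dd ll cl lm, 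
        where ds = "\<lambda>_. 0", OF tendsto_const _ LIMSEQ_inverse_real_of_nat feas])
    fix \<mu> assume "- grad f x \<in> dir_subdiff (scalarization \<mu> F) x 0"
      and "\<mu> \<in> dir_normal_cone \<Gamma> (F x) (dir_deriv F x 0)"
    then show ?thesis by (rule M_stationaryI_dir[OF xX])
  next
    fix K ms ws \<delta>s \<xi>s
    let ?y = "\<lambda>k. x + inverse (real (Suc (k + K))) *\<^sub>R ws k"
    assume m0: "\<And>k. 0 < ms k"
      and val: "\<And>k. f (?y k) + ms k / 2 * (norm (\<delta>s k))\<^sup>2 \<le> f (x + inverse (real (Suc (k + K))) *\<^sub>R 0)"
      and r1: "R1 F \<Gamma> ?y (\<lambda>k. ms k *\<^sub>R \<delta>s k) \<delta>s \<xi>s"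
      and r2: "R2 x (- grad f x) ?y (\<lambda>k. ms k *\<^sub>R \<delta>s k) \<delta>s \<xi>s"
    define ys where "ys = ?y"
    have inf: "filterlim (\<lambda>k. norm (ms k *\<^sub>R \<delta>s k)) at_top sequentially"
      using r2 by (simp add: R2_def)
    have val': "f (ys k) + ms k / 2 * (norm (\<delta>s k))\<^sup>2 \<le> f x" for k
      using val[of k] by (simp add: ys_def)
    have "\<forall>\<^sub>F k in sequentially. 1 \<le> norm (ms k *\<^sub>R \<delta>s k)"
      using inf unfolding filterlim_at_top by blast
    then obtain J where J: "\<And>k. k \<ge> J \<Longrightarrow> 1 \<le> norm (ms k *\<^sub>R \<delta>s k)"
      unfolding eventually_sequentially by blast
    \<comment> \<open>At \<open>x\<close> the estimate on values leaves no room for a penalty, which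
      forces \<open>\<delta>s k = 0\<close> against the size of the multiplier.\<close>
    have ne: "ys k \<noteq> x" if "k \<ge> J" for k
    proof
      assume "ys k = x"
      then have "ms k / 2 * (norm (\<delta>s k))\<^sup>2 \<le> 0" using val'[of k] by simp
      then have "\<delta>s k = 0" using m0[of k] by (simp add: mult_le_0_iff)
      then show False using J[OF that] by simp
    qed
    have "\<forall>k. sgn (ys (k + J) - x) \<in> sphere 0 1"
      using ne by (simp add: norm_sgn)
    then obtain d r' where d1: "d \<in> sphere 0 1" and r': "strict_mono r'"
      and d': "((\<lambda>k. sgn (ys (k + J) - x)) \<circ> r') \<longlonglongrightarrow> d"
      using seq_compactE[OF compact_imp_seq_compact[OF compact_sphere]] by metis
    define r where "r k = r' k + J" for k
    have r: "strict_mono r" using r' by (simp add: r_def strict_mono_def)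
    define xs where "xs k = ys (r k)" for k
    \<comment> \<open>The distance to \<open>x\<close> replaces the original step length, relative
      to which the iterates have limit direction 0.\<close>
    define \<tau> where "\<tau> k = norm (xs k - x)" for k
    define W where "W k = sgn (xs k - x)" for k
    have W: "W \<longlonglongrightarrow> d" using d' by (simp add: W_def[abs_def] xs_def r_def o_def)
    have xne: "xs k \<noteq> x" for k using ne by (simp add: xs_def r_def)
    have \<tau>0: "0 < \<tau> k" for k using xne by (simp add: \<tau>_def)
    have xW: "x + \<tau> k *\<^sub>R W k = xs k" for k
      using xne[of k] by (simp add: \<tau>_def W_def sgn_div_norm)
    have r1': "R1 F \<Gamma> xs (\<lambda>k. ms (r k) *\<^sub>R \<delta>s (r k)) (\<lambda>k. \<delta>s (r k)) (\<lambda>k. \<xi>s (r k))"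
      using R1_subseq[OF r1, of r] unfolding xs_def ys_def .
    have r2': "R2 x (- grad f x) xs (\<lambda>k. ms (r k) *\<^sub>R \<delta>s (r k)) (\<lambda>k. \<delta>s (r k)) (\<lambda>k. \<xi>s (r k))"
      using R2_subseq[OF r2 r] unfolding xs_def ys_def .
    have inf': "filterlim (\<lambda>k. norm (ms (r k) *\<^sub>R \<delta>s (r k))) at_top sequentially"
      and xs: "xs \<longlonglongrightarrow> x"
      using r2' by (simp_all add: R2_def)
    have \<tau>: "\<tau> \<longlonglongrightarrow> 0"
      unfolding \<tau>_def using tendsto_norm_zero[OF LIM_zero[OF xs]] .
    define g where "g k = (f (xs k) - f x) / \<tau> k" for k
    have "GDERIV f x :> grad f x"
      using cd by (intro GDERIV_grad) (simp add: continuously_differentiable_def)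
    from GDERIV_quotient_tendsto[OF this W \<tau>0 \<tau>]
    have g: "g \<longlonglongrightarrow> d \<bullet> grad f x" by (simp add: xW g_def[abs_def])
    define p where "p k = ms (r k) * (norm (\<delta>s (r k)))\<^sup>2 / \<tau> k" for k
    have p0: "0 \<le> p k" for k using m0[of "r k"] \<tau>0[of k] by (simp add: p_def)
    \<comment> \<open>The estimate on values divided by \<open>\<tau> k\<close>. As
      \<open>p k\<close> is nonnegative, \<open>g k\<close> is at most 0, which gives criticality of
      \<open>d\<close>; convergence of \<open>g\<close> in turn bounds \<open>p\<close>, which gives
      (R3).\<close>
    have pg: "p k \<le> - 2 * g k" for k
      using val'[of "r k"] \<tau>0[of k] by (simp add: p_def g_def xs_def field_simps)
    have crit: "d \<bullet> grad f x \<le> 0"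
    proof (rule LIMSEQ_le_const2[OF g])
      have "g k \<le> 0" for k using pg[of k] p0[of k] by linarith
      then show "\<exists>N. \<forall>n\<ge>N. g n \<le> 0" by blast
    qed
    have r3: "R3 x d xs (\<lambda>k. ms (r k) *\<^sub>R \<delta>s (r k)) (\<lambda>k. \<delta>s (r k))"
    proof (rule R3_scaled_multiplier)
      show "(\<lambda>k. (xs k - x) /\<^sub>R norm (xs k - x)) \<longlonglongrightarrow> d"
        using W by (simp add: W_def[abs_def] sgn_div_norm)
      obtain B where B: "\<And>k. norm (g k) \<le> B"
        using convergent_imp_Bseq[OF convergentI[OF g]] unfolding Bseq_def by blast
      show "Bseq (\<lambda>k. ms (r k) * (norm (\<delta>s (r k)))\<^sup>2 / norm (xs k - x))"
        unfolding \<tau>_def[symmetric] p_def[symmetric]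
      proof (rule BseqI')
        show "norm (p k) \<le> 2 * B" for k
          using p0[of k] pg[of k] B[of k] by (simp add: abs_le_iff)
      qed
    qed (use m0 xne inf' in auto)
    \<comment> \<open>The points \<open>F (xs k) - \<delta>s (r k)\<close> belong to
      \<open>\<Gamma>\<close>, as normal cones are empty elsewhere, and are reached from
      \<open>F x\<close> along \<open>us k\<close>. The limit of \<open>us\<close> is therefore
      tangent and places \<open>d\<close> in the linearization cone.\<close>
    define us where "us k = (F (x + \<tau> k *\<^sub>R W k) - F x) /\<^sub>R \<tau> k - \<delta>s (r k) /\<^sub>R \<tau> k" for k
    have "(\<lambda>k. \<delta>s (r k) /\<^sub>R \<tau> k) \<longlonglongrightarrow> 0"
      using r3 by (simp add: R3_def \<tau>_def)
    then have "us \<longlonglongrightarrow> dir_deriv F x d - 0"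
      unfolding us_def by (intro tendsto_diff difference_quotient_tendsto[OF dd ll W \<tau>0 \<tau>])
    moreover have "F x + \<tau> k *\<^sub>R us k \<in> \<Gamma>" for k
    proof -
      have "F x + \<tau> k *\<^sub>R us k = F (xs k) - \<delta>s (r k)"
        using \<tau>0[of k] unfolding us_def xW by (simp add: scaleR_right_diff_distrib)
      then show ?thesis using r1' by (simp add: R1_def normal_cone_def)
    qed
    ultimately have "d \<in> linearization_cone F \<Gamma> x"
      using xX \<tau> \<tau>0 unfolding linearization_cone_def tangent_cone_def by auto
    then have "d \<in> critical_cone f F \<Gamma> x"
      using crit by (simp add: critical_cone_def frechet_derivative_grad[OF cd])
    then have "dir_AM_regular F \<Gamma> x d" using d1 by (intro reg) auto
    then show ?thesis
      using r1' r2' r3 xX unfolding dir_AM_regular_def M_stationary_def by blast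
  qed simp_all
qed

theorem corollary3p34:
  fixes f :: "real ^ 'n \<Rightarrow> real"
    and F :: "real ^ 'n \<Rightarrow> real ^ 'l"
    and \<Gamma> :: "(real ^ 'l) set"
    and x :: "real ^ 'n"
  assumes "continuously_differentiable f"
    and "directionally_differentiable F"
    and "locally_lipschitz F"
    and "\<Gamma> \<noteq> {}"
    and "closed \<Gamma>"
    and "local_minimizer f (F -` \<Gamma>) x"
  shows "(AM_regular F \<Gamma> x \<longrightarrow> M_stationary f F \<Gamma> x) \<and>
    (\<forall>d \<in> implicit_critical_cone f F \<Gamma> x \<inter> sphere 0 1.
       (dir_AM_regular F \<Gamma> x d \<longrightarrow> M_stationary f F \<Gamma> x) \<and>
       (strongly_dir_AM_regular F \<Gamma> x d \<longrightarrow> dir_M_stationary f F \<Gamma> x d)) \<and>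
    (\<forall>d \<in> critical_cone f F \<Gamma> x \<inter> sphere 0 1. GACQ F \<Gamma> x \<longrightarrow>
       (dir_AM_regular F \<Gamma> x d \<longrightarrow> M_stationary f F \<Gamma> x) \<and>
       (strongly_dir_AM_regular F \<Gamma> x d \<longrightarrow> dir_M_stationary f F \<Gamma> x d)) \<and>
    ((\<forall>d \<in> critical_cone f F \<Gamma> x \<inter> sphere 0 1. dir_AM_regular F \<Gamma> x d) \<longrightarrow>
       M_stationary f F \<Gamma> x)"
proof (intro conjI ballI impI)
  note hyps = assms(1,2,3,5,6)
  \<comment> \<open>GACQ makes the two critical cones agree, so the explicit case reduces to the
    implicit one.\<close>
  have implicit: "d \<in> implicit_critical_cone f F \<Gamma> x"
    if "d \<in> critical_cone f F \<Gamma> x \<inter> sphere 0 1" "GACQ F \<Gamma> x" for d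
    using that by (simp add: critical_cone_def implicit_critical_cone_def GACQ_def)
  show "M_stationary f F \<Gamma> x" if "AM_regular F \<Gamma> x"
    using AM_regular_imp_M_stationary[OF hyps that] .
  show "M_stationary f F \<Gamma> x"
    if "d \<in> implicit_critical_cone f F \<Gamma> x \<inter> sphere 0 1" "dir_AM_regular F \<Gamma> x d" for d
    using implicit_critical_imp_stationary(1)[OF hyps] that by auto
  show "dir_M_stationary f F \<Gamma> x d"
    if "d \<in> implicit_critical_cone f F \<Gamma> x \<inter> sphere 0 1" "strongly_dir_AM_regular F \<Gamma> x d" for d
    using implicit_critical_imp_stationary(2)[OF hyps] that by auto
  show "M_stationary f F \<Gamma> x"
    if "d \<in> critical_cone f F \<Gamma> x \<inter> sphere 0 1" "GACQ F \<Gamma> x" "dir_AM_regular F \<Gamma> x d" for d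
    using implicit_critical_imp_stationary(1)[OF hyps implicit[OF that(1,2)]] that by simp
  show "dir_M_stationary f F \<Gamma> x d"
    if "d \<in> critical_cone f F \<Gamma> x \<inter> sphere 0 1" "GACQ F \<Gamma> x" "strongly_dir_AM_regular F \<Gamma> x d" for d
    using implicit_critical_imp_stationary(2)[OF hyps implicit[OF that(1,2)]] that by simp
  show "M_stationary f F \<Gamma> x"
    if "\<forall>d \<in> critical_cone f F \<Gamma> x \<inter> sphere 0 1. dir_AM_regular F \<Gamma> x d"
    using all_directions_imp_M_stationary[OF hyps] that by simp
qed

end
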